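(* Let $A$ be a quasitriangular ribbon Hopf algebra over a field $k$ with universal $R$-matrix $\rho=\sum e\otimes e'\in A\otimes A$, $\rho^{-1}=\sum E\otimes E'$, antipode $s$, and grouplike element $G\in A$ such that $s^2(a)=G^{-1}aG$ for all $a\in A$. Let $V$ be a finite-dimensional representation of $A$. Then $V$ gives rise to an invariant of regular isotopy of oriented knots and links: the evaluation of oriented link diagrams in Morse position obtained by assigning to the cups, caps and crossings the linear maps listed in the context (each closed diagram being evaluated as a linear map $k\to k$, whose value is its image of $1$) takes equal values on regularly isotopic diagrams.
   Context: **Diagrams.** Oriented link diagrams are drawn in Morse position with respect to a vertical direction, i.e. as vertical compositions and horizontal juxtapositions of caps (local maxima), cups (local minima), crossings and vertical strands. Regular isotopy is generated by planar isotopies (including cancellation of adjacent maximum/minimum pairs and switchback moves passing a strand across a maximum or minimum) and the Reidemeister moves II and III with all orientations (not Reidemeister I). **Evaluation.** Diagrams are read from bottom to top; an upward strand corresponds to $V$, a downward strand to the dual space $V^*$, juxtaposition to $\otimes$. For $a\in A$ acting on $V$, $a^t$ denotes the transpose on $V^*$: $(a^tf)(v)=f(av)$. Let $\{\beta\}$ be a basis of $V$ with dual basis $\{\beta^*\}$. * Cap oriented left to right (clockwise): $V\otimes V^*\to k$, $x\otimes f\mapsto f(G^{-1}x)$. * Cup oriented left to right (counterclockwise; left leg down, right leg up): $k\to V^*\otimes V$, $1\mapsto\sum_\beta \beta^*\otimes G\beta$. * Cap oriented right to left: evaluation $V^*\otimes V\to k$, $f\otimes x\mapsto f(x)$. * Cup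 oriented right to left: coevaluation $k\to V\otimes V^*$, $1\mapsto \sum_\beta\beta\otimes\beta^*$. * Positive crossing, both strands up (overcrossing strand from lower left to upper right): $V\otimes V\to V\otimes V$, $x\otimes y\mapsto \sum e'y\otimes ex$. Negative crossing, both strands up: $x\otimes y\mapsto\sum Ey\otimes E'x$. * Positive crossing, both strands down: $V^*\otimes V^*\to V^*\otimes V^*$, $f\otimes g\mapsto \sum e'^tg\otimes e^tf$. Negative crossing, both strands down: $f\otimes g\mapsto \sum E^tg\otimes E'^tf$. * A crossing with one strand up and one strand down is evaluated by rewriting it, via a planar isotopy (switchback move), as the composite of a crossing of one of the preceding types with one cap and one cup. *)

theory Defs
  imports Complex_Main "HOL-Library.Poly_Mapping"
begin

section \<open>Tensor products\<close>

text \<open>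
  \<^typ>\<open>'w \<Rightarrow>\<^sub>0 'k\<close> is the free vector space over \<open>'k\<close> on the set \<open>'w\<close>. A word
  \<open>[a\<^sub>1, \<dots>, a\<^sub>n]\<close> stands for the pure tensor \<open>a\<^sub>1 \<otimes> \<dots> \<otimes> a\<^sub>n\<close>.
\<close>

definition fscale :: "'k::field \<Rightarrow> ('w \<Rightarrow>\<^sub>0 'k) \<Rightarrow> ('w \<Rightarrow>\<^sub>0 'k)"
  where "fscale c x = Poly_Mapping.map ((*) c) x"

lemma lookup_fscale [simp]:
  "Poly_Mapping.lookup (fscale c x) w = c * Poly_Mapping.lookup x w"
  by (simp add: fscale_def Poly_Mapping.map.rep_eq when_def)

interpretation free_space: vector_space fscale
  by unfold_locales (auto intro!: poly_mapping_eqI simp: lookup_add algebra_simps)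

abbreviation pure :: "'w \<Rightarrow> ('w \<Rightarrow>\<^sub>0 'k::field)"
  where "pure w \<equiv> Poly_Mapping.single w 1"

definition lin_ext :: "('w \<Rightarrow> ('u \<Rightarrow>\<^sub>0 'k::field)) \<Rightarrow> ('w \<Rightarrow>\<^sub>0 'k) \<Rightarrow> ('u \<Rightarrow>\<^sub>0 'k)"
  where "lin_ext f x = (\<Sum>w\<in>Poly_Mapping.keys x. fscale (Poly_Mapping.lookup x w) (f w))"

definition multilinear_relators ::
    "('k::field \<Rightarrow> 'a \<Rightarrow> 'a) \<Rightarrow> ('a::ab_group_add list \<Rightarrow>\<^sub>0 'k) set"
  where "multilinear_relators scale =
     {pure (x @ (a + b) # y) - pure (x @ a # y) - pure (x @ b # y) | x a b y. True} \<union>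
     {pure (x @ scale c a # y) - fscale c (pure (x @ a # y)) | x c a y. True}"

text \<open>
  \<open>A\<^sup>\<otimes>\<^sup>n\<close> is the span of the words of length \<open>n\<close> modulo the span of the relators; since the
  relators are homogeneous, all \<open>n\<close> are treated at once. Every element of \<open>A \<otimes> A\<close> or
  \<open>A \<otimes> A \<otimes> A\<close> is a finite sum of pure tensors and is presented by a list of pairs or
  triples; the relations below say that two such lists present the same element.
\<close>

definition tensor_eq :: "('k::field \<Rightarrow> 'a \<Rightarrow> 'a) \<Rightarrow> 'a::ab_group_add list list \<Rightarrow> 'a list list \<Rightarrow> bool"
  where "tensor_eq scale xs ys \<longleftrightarrow>
    (\<Sum>w\<leftarrow>xs. pure w) - (\<Sum>w\<leftarrow>ys. pure w) \<in> module.span fscale (multilinear_relators scale)"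

definition tensor_eq2 ::
    "('k::field \<Rightarrow> 'a \<Rightarrow> 'a) \<Rightarrow> ('a::ab_group_add \<times> 'a) list \<Rightarrow> ('a \<times> 'a) list \<Rightarrow> bool"
  where "tensor_eq2 scale xs ys \<longleftrightarrow>
    tensor_eq scale (map (\<lambda>(a, b). [a, b]) xs) (map (\<lambda>(a, b). [a, b]) ys)"

definition tensor_eq3 ::
    "('k::field \<Rightarrow> 'a \<Rightarrow> 'a) \<Rightarrow> ('a::ab_group_add \<times> 'a \<times> 'a) list \<Rightarrow> ('a \<times> 'a \<times> 'a) list \<Rightarrow> bool"
  where "tensor_eq3 scale xs ys \<longleftrightarrow>
    tensor_eq scale (map (\<lambda>(a, b, c). [a, b, c]) xs) (map (\<lambda>(a, b, c). [a, b, c]) ys)"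

definition tmult2 :: "('a::times \<times> 'a) list \<Rightarrow> ('a \<times> 'a) list \<Rightarrow> ('a \<times> 'a) list"
  where "tmult2 xs ys = [(a * c, b * d). (a, b) \<leftarrow> xs, (c, d) \<leftarrow> ys]"

definition tmult3 :: "('a::times \<times> 'a \<times> 'a) list \<Rightarrow> ('a \<times> 'a \<times> 'a) list \<Rightarrow> ('a \<times> 'a \<times> 'a) list"
  where "tmult3 xs ys = [(a * d, b * e, c * f). (a, b, c) \<leftarrow> xs, (d, e, f) \<leftarrow> ys]"

definition flip2 :: "('a \<times> 'a) list \<Rightarrow> ('a \<times> 'a) list"
  where "flip2 xs = [(b, a). (a, b) \<leftarrow> xs]"


section \<open>Quasitriangular ribbon Hopf algebras\<close>

locale hopf_algebra = vector_space scale
  for scale :: "'k::field \<Rightarrow> 'a::ring_1 \<Rightarrow> 'a" +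
  fixes comult :: "'a \<Rightarrow> ('a \<times> 'a) list"
    and counit :: "'a \<Rightarrow> 'k"
    and antipode :: "'a \<Rightarrow> 'a"
  assumes mult_scale_left: "scale c a * b = scale c (a * b)"
    and mult_scale_right: "a * scale c b = scale c (a * b)"
    and comult_add: "tensor_eq2 scale (comult (a + b)) (comult a @ comult b)"
    and comult_scale: "tensor_eq2 scale (comult (scale c a)) [(scale c x, y). (x, y) \<leftarrow> comult a]"
    and coassoc:
      "tensor_eq3 scale [(x\<^sub>1, x\<^sub>2, y). (x, y) \<leftarrow> comult a, (x\<^sub>1, x\<^sub>2) \<leftarrow> comult x]
                        [(x, y\<^sub>1, y\<^sub>2). (x, y) \<leftarrow> comult a, (y\<^sub>1, y\<^sub>2) \<leftarrow> comult y]"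
    and counit_linear: "Vector_Spaces.linear scale (*) counit"
    and counit_left: "(\<Sum>(x, y)\<leftarrow>comult a. scale (counit x) y) = a"
    and counit_right: "(\<Sum>(x, y)\<leftarrow>comult a. scale (counit y) x) = a"
    and comult_one: "tensor_eq2 scale (comult 1) [(1, 1)]"
    and comult_mult: "tensor_eq2 scale (comult (a * b)) (tmult2 (comult a) (comult b))"
    and counit_one: "counit 1 = 1"
    and counit_mult: "counit (a * b) = counit a * counit b"
    and antipode_linear: "Vector_Spaces.linear scale scale antipode"
    and antipode_left: "(\<Sum>(x, y)\<leftarrow>comult a. antipode x * y) = scale (counit a) 1"
    and antipode_right: "(\<Sum>(x, y)\<leftarrow>comult a. x * antipode y) = scale (counit a) 1"

locale quasitriangular_hopf_algebra = hopf_algebra scale comult counit antipode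
  for scale :: "'k::field \<Rightarrow> 'a::ring_1 \<Rightarrow> 'a" and comult and counit and antipode +
  fixes R Rinv :: "('a \<times> 'a) list"
  assumes R_Rinv: "tensor_eq2 scale (tmult2 R Rinv) [(1, 1)]"
    and Rinv_R: "tensor_eq2 scale (tmult2 Rinv R) [(1, 1)]"
    and R_comult: "tensor_eq2 scale (tmult2 R (comult a)) (tmult2 (flip2 (comult a)) R)"
    and comult_id_R: \<comment> \<open>\<open>(\<Delta> \<otimes> id) \<rho> = \<rho>\<^sub>1\<^sub>3 \<rho>\<^sub>2\<^sub>3\<close>\<close>
      "tensor_eq3 scale [(x, y, e'). (e, e') \<leftarrow> R, (x, y) \<leftarrow> comult e]
         (tmult3 [(e, 1, e'). (e, e') \<leftarrow> R] [(1, e, e'). (e, e') \<leftarrow> R])"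
    and id_comult_R: \<comment> \<open>\<open>(id \<otimes> \<Delta>) \<rho> = \<rho>\<^sub>1\<^sub>3 \<rho>\<^sub>1\<^sub>2\<close>\<close>
      "tensor_eq3 scale [(e, x, y). (e, e') \<leftarrow> R, (x, y) \<leftarrow> comult e']
         (tmult3 [(e, 1, e'). (e, e') \<leftarrow> R] [(e, e', 1). (e, e') \<leftarrow> R])"
begin

definition drinfeld_element :: 'a
  where "drinfeld_element = (\<Sum>(e, e')\<leftarrow>R. antipode e' * e)"

end

text \<open>The ribbon element \<open>v\<close> is that of Reshetikhin and Turaev.\<close>

locale ribbon_hopf_algebra = quasitriangular_hopf_algebra scale comult counit antipode R Rinv
  for scale :: "'k::field \<Rightarrow> 'a::ring_1 \<Rightarrow> 'a" and comult and counit and antipode and R and Rinv +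
  fixes v :: 'a
  assumes ribbon_central: "v * a = a * v"
    and ribbon_square: "v * v = drinfeld_element * antipode drinfeld_element"
    and ribbon_antipode: "antipode v = v"
    and ribbon_counit: "counit v = 1"
    and ribbon_comult: \<comment> \<open>\<open>\<Delta>(v) = (\<rho>\<^sub>2\<^sub>1 \<rho>)\<^sup>-\<^sup>1 (v \<otimes> v)\<close>\<close>
      "tensor_eq2 scale (comult v) (tmult2 (tmult2 Rinv (flip2 Rinv)) [(v, v)])"

definition grouplike ::
    "('k::field \<Rightarrow> 'a \<Rightarrow> 'a) \<Rightarrow> ('a \<Rightarrow> ('a \<times> 'a) list) \<Rightarrow> ('a \<Rightarrow> 'k) \<Rightarrow> 'a::ab_group_add \<Rightarrow> bool"
  where "grouplike scale comult counit g \<longleftrightarrow>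
    tensor_eq2 scale (comult g) [(g, g)] \<and> counit g = 1"

locale fin_dim_representation =
  finite_dimensional_vector_space scaleV B
  for scale :: "'k::field \<Rightarrow> 'a::ring_1 \<Rightarrow> 'a"
    and scaleV :: "'k \<Rightarrow> 'v::ab_group_add \<Rightarrow> 'v" and B :: "'v set" +
  fixes act :: "'a \<Rightarrow> 'v \<Rightarrow> 'v"
  assumes act_linear: "Vector_Spaces.linear scaleV scaleV (act a)"
    and act_add: "act (a + b) x = act a x + act b x"
    and act_scale: "act (scale c a) x = scaleV c (act a x)"
    and act_one: "act 1 x = x"
    and act_mult: "act (a * b) x = act a (act b x)"


section \<open>Oriented link diagrams in Morse position\<close>

datatype orient = Up | Down

fun opp :: "orient \<Rightarrow> orient" where
  "opp Up = Down"
| "opp Down = Up"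

text \<open>
  \<^item> The argument of \<open>Cap\<close> and \<open>Cup\<close> is the orientation of the left leg: \<open>Cap Up\<close> and \<open>Cup Down\<close>
    are oriented left to right, \<open>Cap Down\<close> and \<open>Cup Up\<close> right to left.
  \<^item> In \<open>Cross b p q\<close>, \<open>p\<close> and \<open>q\<close> are the orientations of the strands with lower left and
    lower right end; \<open>b\<close> says that the strand from lower left to upper right is the overcrossing
    one. So \<open>Cross True Up Up\<close> and \<open>Cross True Down Down\<close> are positive.
  \<^item> \<open>Strands []\<close> is the empty diagram.
  \<^item> In \<open>Stack S T\<close> the diagram \<open>S\<close> is below \<open>T\<close>.
\<close>

datatype diagram =
    Strands "orient list"
  | Cap orient
  | Cup orient
  | Cross bool orient orient
  | Stack diagram diagram  (infixl \<open>\<Zsemi>\<close> 65)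
  | Juxt diagram diagram  (infixl \<open>\<oplus>\<close> 70)

primrec source :: "diagram \<Rightarrow> orient list" where
  "source (Strands w) = w"
| "source (Cap p) = [p, opp p]"
| "source (Cup p) = []"
| "source (Cross b p q) = [p, q]"
| "source (S \<Zsemi> T) = source S"
| "source (S \<oplus> T) = source S @ source T"

primrec target :: "diagram \<Rightarrow> orient list" where
  "target (Strands w) = w"
| "target (Cap p) = []"
| "target (Cup p) = [p, opp p]"
| "target (Cross b p q) = [q, p]"
| "target (S \<Zsemi> T) = target T"
| "target (S \<oplus> T) = target S @ target T"

primrec composable :: "diagram \<Rightarrow> bool" where
  "composable (Strands w) \<longleftrightarrow> True"
| "composable (Cap p) \<longleftrightarrow> True"
| "composable (Cup p) \<longleftrightarrow> True"
| "composable (Cross b p q) \<longleftrightarrow> True"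
| "composable (S \<Zsemi> T) \<longleftrightarrow> composable S \<and> composable T \<and> target S = source T"
| "composable (S \<oplus> T) \<longleftrightarrow> composable S \<and> composable T"

definition link_diagram :: "diagram \<Rightarrow> bool"
  where "link_diagram D \<longleftrightarrow> composable D \<and> source D = [] \<and> target D = []"

text \<open>
  In \<open>R3\<close> the strands are numbered from left to right at the bottom, and \<open>b\<^sub>i\<^sub>j\<close> says that strand
  \<open>i\<close> passes over strand \<open>j\<close>; the premise excludes the two cyclic patterns, in which the strands
  cannot be assigned three different heights.
\<close>

inductive regularly_isotopic :: "diagram \<Rightarrow> diagram \<Rightarrow> bool"  (infix \<open>\<approx>\<close> 50) where
  refl: "composable S \<Longrightarrow> S \<approx> S"
| sym: "S \<approx> T \<Longrightarrow> T \<approx> S"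
| trans: "S \<approx> T \<Longrightarrow> T \<approx> U \<Longrightarrow> S \<approx> U"
| stack: "S \<approx> S' \<Longrightarrow> T \<approx> T' \<Longrightarrow> target S = source T \<Longrightarrow> S \<Zsemi> T \<approx> S' \<Zsemi> T'"
| juxt: "S \<approx> S' \<Longrightarrow> T \<approx> T' \<Longrightarrow> S \<oplus> T \<approx> S' \<oplus> T'"
  \<comment> \<open>up to \<open>interchange\<close>: planar isotopy that creates no critical points and only exchanges the
      heights of distant ones\<close>
| stack_assoc: "composable (S \<Zsemi> T \<Zsemi> U) \<Longrightarrow> S \<Zsemi> T \<Zsemi> U \<approx> S \<Zsemi> (T \<Zsemi> U)"
| stack_strands_left: "composable S \<Longrightarrow> Strands (source S) \<Zsemi> S \<approx> S"
| stack_strands_right: "composable S \<Longrightarrow> S \<Zsemi> Strands (target S) \<approx> S"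
| juxt_assoc: "composable (S \<oplus> T \<oplus> U) \<Longrightarrow> S \<oplus> T \<oplus> U \<approx> S \<oplus> (T \<oplus> U)"
| juxt_empty_left: "composable S \<Longrightarrow> Strands [] \<oplus> S \<approx> S"
| juxt_empty_right: "composable S \<Longrightarrow> S \<oplus> Strands [] \<approx> S"
| juxt_strands: "Strands w \<oplus> Strands w' \<approx> Strands (w @ w')"
| interchange: "composable (S \<Zsemi> T) \<Longrightarrow> composable (S' \<Zsemi> T') \<Longrightarrow>
    (S \<oplus> S') \<Zsemi> (T \<oplus> T') \<approx> (S \<Zsemi> T) \<oplus> (S' \<Zsemi> T')"
| cancel_left: "(Strands [p] \<oplus> Cup (opp p)) \<Zsemi> (Cap p \<oplus> Strands [p]) \<approx> Strands [p]"
| cancel_right: "(Cup p \<oplus> Strands [p]) \<Zsemi> (Strands [p] \<oplus> Cap (opp p)) \<approx> Strands [p]"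
| switchback_cap:
    "(Cross b p q \<oplus> Strands [opp p]) \<Zsemi> (Strands [q] \<oplus> Cap p) \<approx>
     (Strands [p] \<oplus> Cross (\<not> b) q (opp p)) \<Zsemi> (Cap p \<oplus> Strands [q])"
| switchback_cup:
    "(Strands [q] \<oplus> Cup p) \<Zsemi> (Cross b q p \<oplus> Strands [opp p]) \<approx>
     (Cup p \<oplus> Strands [q]) \<Zsemi> (Strands [p] \<oplus> Cross (\<not> b) (opp p) q)"
| R2: "Cross b p q \<Zsemi> Cross (\<not> b) q p \<approx> Strands [p, q]"
| R3: "(b\<^sub>1\<^sub>2 = b\<^sub>2\<^sub>3 \<longrightarrow> b\<^sub>1\<^sub>3 = b\<^sub>1\<^sub>2) \<Longrightarrow>
    (Cross b\<^sub>1\<^sub>2 p q \<oplus> Strands [r]) \<Zsemi> (Strands [q] \<oplus> Cross b\<^sub>1\<^sub>3 p r) \<Zsemi> (Cross b\<^sub>2\<^sub>3 q r \<oplus> Strands [p]) \<approx>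
    (Strands [p] \<oplus> Cross b\<^sub>2\<^sub>3 q r) \<Zsemi> (Cross b\<^sub>1\<^sub>3 p r \<oplus> Strands [q]) \<Zsemi> (Strands [r] \<oplus> Cross b\<^sub>1\<^sub>2 p q)"

text \<open>
  \<open>resolve\<close> rewrites the crossings with one strand up and one strand down by a switchback move,
  bending the strand with lower left end, so that both strands have the orientation of the other
  one. Bending the other strand instead gives a regularly isotopic diagram.
\<close>

primrec resolve :: "diagram \<Rightarrow> diagram" where
  "resolve (Strands w) = Strands w"
| "resolve (Cap p) = Cap p"
| "resolve (Cup p) = Cup p"
| "resolve (Cross b p q) =
    (if p = q then Cross b p q
     else (Strands [p, q] \<oplus> Cup q) \<Zsemi> (Strands [p] \<oplus> Cross (\<not> b) q q \<oplus> Strands [p]) \<Zsemi>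
          (Cap p \<oplus> Strands [q, p]))"
| "resolve (S \<Zsemi> T) = resolve S \<Zsemi> resolve T"
| "resolve (S \<oplus> T) = resolve S \<oplus> resolve T"

lemma resolve_shape [simp]: "source (resolve S) = source S" "target (resolve S) = target S"
proof (induction S)
  case (Cross b p q)
  { case 1 show ?case by (cases p; cases q) auto next
    case 2 show ?case by (cases p; cases q) auto }
qed auto

lemma composable_resolve: "composable S \<Longrightarrow> composable (resolve S)"
proof (induction S)
  case (Cross b p q) show ?case by (cases p; cases q) auto
qed auto


section \<open>Evaluation\<close>

text \<open>
  Linear maps between tensor products of copies of \<open>V\<close> and \<open>V\<^sup>*\<close> are given by their values on
  pure tensors, i.e. words whose letters are vectors or linear forms. They are composed on the
  free vector space on the words. The multilinearity relations only involve nonempty words,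
  so the component of the empty word is the tensor power \<open>k\<close> of degree 0 itself.
\<close>

datatype ('v, 'k) letter = Vec 'v | Form "'v \<Rightarrow> 'k"

primrec letter_orient :: "('v, 'k) letter \<Rightarrow> orient" where
  "letter_orient (Vec x) = Up"
| "letter_orient (Form f) = Down"

lemma keys_lin_ext:
  "Poly_Mapping.keys (lin_ext f x) \<subseteq> (\<Union>w\<in>Poly_Mapping.keys x. Poly_Mapping.keys (f w))"
proof
  fix u assume "u \<in> Poly_Mapping.keys (lin_ext f x)"
  then have "Poly_Mapping.lookup (lin_ext f x) u \<noteq> 0"
    by (simp add: in_keys_iff)
  then have "(\<Sum>w\<in>Poly_Mapping.keys x.
      Poly_Mapping.lookup x w * Poly_Mapping.lookup (f w) u) \<noteq> 0"
    by (simp add: lin_ext_def lookup_sum)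
  then obtain w where "w \<in> Poly_Mapping.keys x"
    "Poly_Mapping.lookup x w * Poly_Mapping.lookup (f w) u \<noteq> 0"
    by (meson sum.neutral)
  then show "u \<in> (\<Union>w\<in>Poly_Mapping.keys x. Poly_Mapping.keys (f w))"
    by (auto simp: in_keys_iff)
qed

lemma keys_lin_extE:
  assumes "u \<in> Poly_Mapping.keys (lin_ext f x)"
  obtains w where "w \<in> Poly_Mapping.keys x" and "u \<in> Poly_Mapping.keys (f w)"
  using subsetD[OF keys_lin_ext assms] by blast

lemma keys_sum_list_subset:
  "(\<And>a. a \<in> set xs \<Longrightarrow> Poly_Mapping.keys (f a) \<subseteq> K) \<Longrightarrow> Poly_Mapping.keys (\<Sum>a\<leftarrow>xs. f a) \<subseteq> K"
proof (induction xs)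
  case (Cons a xs)
  have "Poly_Mapping.keys (f a) \<subseteq> K" and "Poly_Mapping.keys (\<Sum>a\<leftarrow>xs. f a) \<subseteq> K"
    using Cons by simp_all
  then show ?case
    using Poly_Mapping.keys_add[of "f a" "\<Sum>a\<leftarrow>xs. f a"] by auto
qed simp

lemma keys_sum_subset:
  "(\<And>a. a \<in> A \<Longrightarrow> Poly_Mapping.keys (f a) \<subseteq> K) \<Longrightarrow> Poly_Mapping.keys (\<Sum>a\<in>A. f a) \<subseteq> K"
  using Poly_Mapping.keys_sum[of f A] by blast

context
  fixes scaleV :: "'k::field \<Rightarrow> 'v::ab_group_add \<Rightarrow> 'v"
    and B :: "'v set"
    and act :: "'a \<Rightarrow> 'v \<Rightarrow> 'v"
    and R Rinv :: "('a \<times> 'a) list"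
    and G Ginv :: 'a
begin

definition dual_vector :: "'v \<Rightarrow> 'v \<Rightarrow> 'k"
  where "dual_vector \<beta> = (\<lambda>x. module.representation scaleV B x \<beta>)"

definition transp :: "'a \<Rightarrow> ('v \<Rightarrow> 'k) \<Rightarrow> ('v \<Rightarrow> 'k)"
  where "transp a f = (\<lambda>x. f (act a x))"

fun eval_cap :: "orient \<Rightarrow> ('v, 'k) letter list \<Rightarrow> (('v, 'k) letter list \<Rightarrow>\<^sub>0 'k)" where
  "eval_cap Up [Vec x, Form f] = fscale (f (act Ginv x)) (pure [])"
| "eval_cap Down [Form f, Vec x] = fscale (f x) (pure [])"
| "eval_cap _ _ = 0"

fun eval_cup :: "orient \<Rightarrow> ('v, 'k) letter list \<Rightarrow> (('v, 'k) letter list \<Rightarrow>\<^sub>0 'k)" where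
  "eval_cup Down [] = (\<Sum>\<beta>\<in>B. pure [Form (dual_vector \<beta>), Vec (act G \<beta>)])"
| "eval_cup Up [] = (\<Sum>\<beta>\<in>B. pure [Vec \<beta>, Form (dual_vector \<beta>)])"
| "eval_cup _ _ = 0"

fun eval_cross :: "bool \<Rightarrow> orient \<Rightarrow> orient \<Rightarrow> ('v, 'k) letter list \<Rightarrow> (('v, 'k) letter list \<Rightarrow>\<^sub>0 'k)"
where
  "eval_cross True Up Up [Vec x, Vec y] = (\<Sum>(e, e')\<leftarrow>R. pure [Vec (act e' y), Vec (act e x)])"
| "eval_cross False Up Up [Vec x, Vec y] = (\<Sum>(E, E')\<leftarrow>Rinv. pure [Vec (act E y), Vec (act E' x)])"
| "eval_cross True Down Down [Form f, Form g] =
     (\<Sum>(e, e')\<leftarrow>R. pure [Form (transp e' g), Form (transp e f)])"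
| "eval_cross False Down Down [Form f, Form g] =
     (\<Sum>(E, E')\<leftarrow>Rinv. pure [Form (transp E g), Form (transp E' f)])"
| "eval_cross _ _ _ _ = 0"

text \<open>The crossings with two different orientations do not occur in a resolved diagram.\<close>

primrec eval_resolved :: "diagram \<Rightarrow> ('v, 'k) letter list \<Rightarrow> (('v, 'k) letter list \<Rightarrow>\<^sub>0 'k)" where
  "eval_resolved (Strands w) = pure"
| "eval_resolved (Cap p) = eval_cap p"
| "eval_resolved (Cup p) = eval_cup p"
| "eval_resolved (Cross b p q) = eval_cross b p q"
| "eval_resolved (S \<Zsemi> T) = (\<lambda>w. lin_ext (eval_resolved T) (eval_resolved S w))"
| "eval_resolved (S \<oplus> T) = (\<lambda>w.
     lin_ext (\<lambda>x. lin_ext (\<lambda>y. pure (x @ y)) (eval_resolved T (drop (length (source S)) w)))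
       (eval_resolved S (take (length (source S)) w)))"

definition eval :: "diagram \<Rightarrow> ('v, 'k) letter list \<Rightarrow> (('v, 'k) letter list \<Rightarrow>\<^sub>0 'k)"
  where "eval D = eval_resolved (resolve D)"

definition link_value :: "diagram \<Rightarrow> 'k"
  where "link_value D = Poly_Mapping.lookup (eval D []) []"

lemma keys_eval_resolved:
  assumes "composable S" and "map letter_orient w = source S"
    and "u \<in> Poly_Mapping.keys (eval_resolved S w)"
  shows "map letter_orient u = target S"
  using assms
proof (induction S arbitrary: u w)
  case (Cap p)
  then show ?case by (cases "(p, w)" rule: eval_cap.cases) (auto simp: in_keys_iff lookup_single when_def split: if_splits)
next
  case (Cup p)
  have "Poly_Mapping.keys (eval_cup p w) \<subseteq> {u. map letter_orient u = [p, opp p]}"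
    using Cup.prems by (cases p) (auto intro!: keys_sum_subset)
  with Cup.prems show ?case by auto
next
  case (Cross b p q)
  have "Poly_Mapping.keys (eval_cross b p q w) \<subseteq> {u. map letter_orient u = [q, p]}"
    using Cross.prems(2)
    by (cases "(b, p, q, w)" rule: eval_cross.cases)
      (auto intro!: keys_sum_list_subset split: prod.splits)
  with Cross.prems show ?case by auto
next
  case (Stack S T)
  obtain x where x: "x \<in> Poly_Mapping.keys (eval_resolved S w)"
    and u: "u \<in> Poly_Mapping.keys (eval_resolved T x)"
    using Stack.prems(3) by (auto elim: keys_lin_extE)
  have "map letter_orient x = source T"
    using Stack.IH(1)[of w x] Stack.prems x by simp
  then show ?case
    using Stack.IH(2)[of x u] Stack.prems(1) u by simp
next
  case (Juxt S T)
  let ?n = "length (source S)"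
  have "u \<in> Poly_Mapping.keys (lin_ext
      (\<lambda>x. lin_ext (\<lambda>y. pure (x @ y)) (eval_resolved T (drop ?n w))) (eval_resolved S (take ?n w)))"
    using Juxt.prems(3) by simp
  then obtain x where x: "x \<in> Poly_Mapping.keys (eval_resolved S (take ?n w))"
    and ux: "u \<in> Poly_Mapping.keys (lin_ext (\<lambda>y. pure (x @ y)) (eval_resolved T (drop ?n w)))"
    by (rule keys_lin_extE)
  from ux obtain y where y: "y \<in> Poly_Mapping.keys (eval_resolved T (drop ?n w))"
    and "u \<in> Poly_Mapping.keys (pure (x @ y) :: _ \<Rightarrow>\<^sub>0 'k)"
    by (rule keys_lin_extE)
  then have u: "u = x @ y" by simp
  have "map letter_orient (take ?n w) = source S" "map letter_orient (drop ?n w) = source T"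
    using Juxt.prems(2) by (simp_all add: take_map[symmetric] drop_map[symmetric])
  then show ?case
    using Juxt.IH(1)[of "take ?n w" x] Juxt.IH(2)[of "drop ?n w" y] Juxt.prems(1) x y u by simp
qed auto

text \<open>The image of \<open>1\<close> under a link diagram is \<open>link_value D\<close> times \<open>1\<close>.\<close>

lemma eval_link_diagram:
  assumes "link_diagram D"
  shows "eval D [] = fscale (link_value D) (pure [])"
proof (rule poly_mapping_eqI)
  fix u
  have "u = []" if "u \<in> Poly_Mapping.keys (eval D [])"
    using keys_eval_resolved[of "resolve D" "[]" u] that assms
    by (auto simp: eval_def link_diagram_def composable_resolve)
  then show "Poly_Mapping.lookup (eval D []) u =
      Poly_Mapping.lookup (fscale (link_value D) (pure [])) u"
    by (auto simp: link_value_def lookup_single when_def in_keys_iff)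
qed

end

end

theory Submission
  imports Defs
begin

text \<open>
  A downward strand is given the dual representation, in which \<open>a\<close> sends the form \<open>f\<close> to
  \<open>f \<circ> s(a)\<close>. Read in this way, the crossings of all four orientation types are evaluated by one
  formula: if the strand from lower left to upper right passes over, act by \<open>\<rho>\<close> on the two strands
  and exchange them; otherwise act by \<open>\<rho>\<^sub>2\<^sub>1\<^sup>-\<^sup>1\<close> and exchange them. For two downward strands this is the
  identity \<open>(s \<otimes> s) \<rho> = \<rho>\<close> (\<open>pairing_antipode_antipode_R\<close>); for a resolved mixed crossing it is
  \<open>same_matrix_mixed_crossing\<close>.

  Since every strand now carries a representation, each of the two Reidemeister moves has one
  proof for all orientations: move II is the invertibility of \<open>\<rho>\<close>, and move III is the Yang-Baxter equation
  for \<open>\<rho>\<close>, in one version for each order of the heights of the three strands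
  (\<open>yang_baxter_crossings\<close>). That the dual space is a representation rests on the antipode being
  an antihomomorphism (\<open>form_antipode_mult\<close>).

  Under a cap or cup, the action of \<open>a\<close> on one leg can be traded for the action of \<open>s(a)\<close> on the
  other (\<open>cap_slide\<close>, \<open>cup_slide\<close>). For the right-to-left ones this is the definition of the dual
  representation; for the left-to-right ones it is the relation \<open>s\<^sup>2(a) = G\<^sup>-\<^sup>1 a G\<close>, and this is why
  \<open>G\<close> occurs in their definition. A strand pulled across a maximum or minimum therefore changes the
  tensor of its crossing by one antipode, and \<open>(s \<otimes> id) \<rho> = \<rho>\<^sup>-\<^sup>1\<close> and \<open>(id \<otimes> s) \<rho>\<^sup>-\<^sup>1 = \<rho>\<close>
  (\<open>pairing_crossing_tensor_antipode\<close>) say that the result is the tensor of the opposite crossing: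
  these are the switchback moves.

  All of this is proved for matrix entries with respect to the basis \<open>B\<close>. The evaluation takes
  place in a free vector space on words, where multilinear relations do not hold on the nose;
  \<open>represents_eval_resolved\<close> shows that it is nevertheless computed by matrices, and for a link
  diagram the matrix is the single number \<open>link_value\<close>.
\<close>

section \<open>Multilinear forms\<close>

text \<open>
  The linear extension of \<open>\<psi>\<close> from the basis of words to the free vector space.
\<close>

definition form_ext :: "('w \<Rightarrow> 'k::field) \<Rightarrow> ('w \<Rightarrow>\<^sub>0 'k) \<Rightarrow> 'k"
  where "form_ext \<psi> x = (\<Sum>w\<in>Poly_Mapping.keys x. Poly_Mapping.lookup x w * \<psi> w)"

lemma form_ext_superset:
  assumes "finite A" and "Poly_Mapping.keys x \<subseteq> A"
  shows "form_ext \<psi> x = (\<Sum>w\<in>A. Poly_Mapping.lookup x w * \<psi> w)"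
  unfolding form_ext_def using assms by (intro sum.mono_neutral_left) (auto simp: in_keys_iff)

lemma form_ext_zero [simp]: "form_ext \<psi> 0 = 0"
  by (simp add: form_ext_def)

lemma form_ext_pure [simp]: "form_ext \<psi> (pure w) = \<psi> w"
  by (simp add: form_ext_def)

lemma form_ext_fscale [simp]: "form_ext \<psi> (fscale c x) = c * form_ext \<psi> x"
proof -
  have "Poly_Mapping.keys (fscale c x) \<subseteq> Poly_Mapping.keys x"
    by (auto simp: in_keys_iff)
  then show ?thesis
    by (subst form_ext_superset[of "Poly_Mapping.keys x"])
      (auto simp: form_ext_def sum_distrib_left mult.assoc)
qed

lemma form_ext_add [simp]: "form_ext \<psi> (x + y) = form_ext \<psi> x + form_ext \<psi> y"
proof -
  let ?A = "Poly_Mapping.keys x \<union> Poly_Mapping.keys y"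
  have "Poly_Mapping.keys (x + y) \<subseteq> ?A"
    by (rule Poly_Mapping.keys_add)
  then show ?thesis
    by (simp add: form_ext_superset[of ?A] lookup_add distrib_right sum.distrib)
qed

lemma form_ext_diff [simp]: "form_ext \<psi> (x - y) = form_ext \<psi> x - form_ext \<psi> y"
  using form_ext_add[of \<psi> "x - y" y] by (simp del: form_ext_add)

lemma form_ext_sum: "form_ext \<psi> (\<Sum>a\<in>A. f a) = (\<Sum>a\<in>A. form_ext \<psi> (f a))"
  by (induction A rule: infinite_finite_induct) auto

lemma form_ext_sum_list: "form_ext \<psi> (\<Sum>a\<leftarrow>xs. f a) = (\<Sum>a\<leftarrow>xs. form_ext \<psi> (f a))"
  by (induction xs) auto

lemma form_ext_lin_ext: "form_ext \<psi> (lin_ext F x) = form_ext (\<lambda>w. form_ext \<psi> (F w)) x"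
  by (simp add: lin_ext_def form_ext_sum) (simp add: form_ext_def)

lemma (in vector_space) linear_form_iff:
  "Vector_Spaces.linear scale (*) f \<longleftrightarrow>
     (\<forall>x y. f (x + y) = f x + f y) \<and> (\<forall>c x. f (scale c x) = c * f x)"
proof -
  have "vector_space ((*) :: 'a \<Rightarrow> 'a \<Rightarrow> 'a)"
    by unfold_locales (auto simp: algebra_simps)
  then show ?thesis
    by (simp add: Vector_Spaces.linear_iff vector_space_axioms)
qed

text \<open>
  Tensors over a field are separated by multilinear forms with values in that field. An
  identity between tensors is therefore used in the form that both sides take the same value on
  every such form, so that no quotient space has to be constructed.
\<close>

definition pairing2 :: "('a \<times> 'a) list \<Rightarrow> ('a \<Rightarrow> 'a \<Rightarrow> 'k::field) \<Rightarrow> 'k"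
  where "pairing2 xs \<phi> = (\<Sum>(a, b)\<leftarrow>xs. \<phi> a b)"

definition pairing3 :: "('a \<times> 'a \<times> 'a) list \<Rightarrow> ('a \<Rightarrow> 'a \<Rightarrow> 'a \<Rightarrow> 'k::field) \<Rightarrow> 'k"
  where "pairing3 xs \<phi> = (\<Sum>(a, b, c)\<leftarrow>xs. \<phi> a b c)"

lemma pairing2_simps [simp]:
  "pairing2 [] \<phi> = 0"
  "pairing2 (p # xs) \<phi> = \<phi> (fst p) (snd p) + pairing2 xs \<phi>"
  "pairing2 (xs @ ys) \<phi> = pairing2 xs \<phi> + pairing2 ys \<phi>"
  by (simp_all add: pairing2_def split_beta)

lemma pairing3_simps [simp]:
  "pairing3 [] \<phi> = 0"
  "pairing3 (p # xs) \<phi> = \<phi> (fst p) (fst (snd p)) (snd (snd p)) + pairing3 xs \<phi>"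
  "pairing3 (xs @ ys) \<phi> = pairing3 xs \<phi> + pairing3 ys \<phi>"
  by (simp_all add: pairing3_def split_beta)

lemma pairing2_flip2: "pairing2 (flip2 xs) \<phi> = pairing2 xs (\<lambda>a b. \<phi> b a)"
  by (induction xs) (auto simp: flip2_def)

lemma pairing2_map: "pairing2 (map f xs) \<phi> = pairing2 xs (\<lambda>a b. \<phi> (fst (f (a, b))) (snd (f (a, b))))"
  by (induction xs) auto

lemma pairing3_map2:
  "pairing3 (map f xs) \<phi> =
     pairing2 xs (\<lambda>a b. \<phi> (fst (f (a, b))) (fst (snd (f (a, b)))) (snd (snd (f (a, b)))))"
  by (induction xs) auto

lemma pairing2_tmult2:
  "pairing2 (tmult2 xs ys) \<phi> = pairing2 xs (\<lambda>a b. pairing2 ys (\<lambda>c d. \<phi> (a * c) (b * d)))"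
proof (induction xs)
  case (Cons p xs)
  have "pairing2 (map (\<lambda>(c, d). (fst p * c, snd p * d)) ys) \<phi> =
      pairing2 ys (\<lambda>c d. \<phi> (fst p * c) (snd p * d))"
    by (simp add: pairing2_map)
  with Cons show ?case by (auto simp: tmult2_def split_beta)
qed (simp add: tmult2_def)

lemma pairing3_tmult3:
  "pairing3 (tmult3 xs ys) \<phi> =
     pairing3 xs (\<lambda>a b c. pairing3 ys (\<lambda>d e f. \<phi> (a * d) (b * e) (c * f)))"
proof (induction xs)
  case (Cons p xs)
  have "pairing3 (map (\<lambda>(d, e, f). (fst p * d, fst (snd p) * e, snd (snd p) * f)) ys) \<phi> =
      pairing3 ys (\<lambda>d e f. \<phi> (fst p * d) (fst (snd p) * e) (snd (snd p) * f))"
    by (induction ys) auto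
  with Cons show ?case by (auto simp: tmult3_def split_beta)
qed (simp add: tmult3_def)

lemma pairing2_add: "pairing2 xs (\<lambda>a b. \<phi> a b + \<psi> a b) = pairing2 xs \<phi> + pairing2 xs \<psi>"
  by (induction xs) (auto simp: algebra_simps)

lemma pairing2_mult_left: "pairing2 xs (\<lambda>a b. c * \<phi> a b) = c * pairing2 xs \<phi>"
  by (induction xs) (auto simp: algebra_simps)

lemma pairing2_mult_right: "pairing2 xs (\<lambda>a b. \<phi> a b * c) = pairing2 xs \<phi> * c"
  by (induction xs) (auto simp: algebra_simps)

lemma pairing2_zero [simp]: "pairing2 xs (\<lambda>a b. 0) = 0"
  by (induction xs) auto

lemma pairing2_sum: "pairing2 xs (\<lambda>a b. \<Sum>m\<in>A. f m a b) = (\<Sum>m\<in>A. pairing2 xs (f m))"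
  by (induction xs) (auto simp: sum.distrib)

lemma pairing2_swap:
  "pairing2 xs (\<lambda>a b. pairing2 ys (\<phi> a b)) = pairing2 ys (\<lambda>c d. pairing2 xs (\<lambda>a b. \<phi> a b c d))"
  by (induction xs) (auto simp: pairing2_add)

lemma pairing3_add:
  "pairing3 xs (\<lambda>a b c. \<phi> a b c + \<psi> a b c) = pairing3 xs \<phi> + pairing3 xs \<psi>"
  by (induction xs) (auto simp: algebra_simps)

lemma pairing3_mult_left: "pairing3 xs (\<lambda>a b c. k * \<phi> a b c) = k * pairing3 xs \<phi>"
  by (induction xs) (auto simp: algebra_simps)

definition bilinear_form :: "('k::field \<Rightarrow> 'a \<Rightarrow> 'a) \<Rightarrow> ('a::ab_group_add \<Rightarrow> 'a \<Rightarrow> 'k) \<Rightarrow> bool"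
  where "bilinear_form scale \<phi> \<longleftrightarrow>
    (\<forall>a. Vector_Spaces.linear scale (*) (\<phi> a)) \<and>
    (\<forall>b. Vector_Spaces.linear scale (*) (\<lambda>a. \<phi> a b))"

definition trilinear_form ::
    "('k::field \<Rightarrow> 'a \<Rightarrow> 'a) \<Rightarrow> ('a::ab_group_add \<Rightarrow> 'a \<Rightarrow> 'a \<Rightarrow> 'k) \<Rightarrow> bool"
  where "trilinear_form scale \<phi> \<longleftrightarrow>
    (\<forall>a. bilinear_form scale (\<phi> a)) \<and>
    (\<forall>b c. Vector_Spaces.linear scale (*) (\<lambda>a. \<phi> a b c))"

context vector_space
begin

text \<open>
  The linear extension of a multilinear \<open>\<psi>\<close> kills the relators, hence their span.
\<close>

lemma form_ext_tensor_eq: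
  assumes "tensor_eq scale xs ys"
    and add: "\<And>x a b y. \<psi> (x @ (a + b) # y) = \<psi> (x @ a # y) + \<psi> (x @ b # y)"
    and scale: "\<And>x c a y. \<psi> (x @ scale c a # y) = c * \<psi> (x @ a # y)"
  shows "sum_list (map \<psi> xs) = sum_list (map \<psi> ys)"
proof -
  let ?K = "{x. form_ext \<psi> x = 0}"
  have "multilinear_relators scale \<subseteq> ?K"
    by (auto simp: multilinear_relators_def add scale)
  moreover have "free_space.subspace ?K"
    by (auto simp: free_space.subspace_def)
  ultimately have "free_space.span (multilinear_relators scale) \<subseteq> ?K"
    by (rule free_space.span_minimal)
  then have "form_ext \<psi> ((\<Sum>w\<leftarrow>xs. pure w) - (\<Sum>w\<leftarrow>ys. pure w)) = 0"
    using assms(1) by (auto simp: tensor_eq_def)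
  then show ?thesis
    by (simp add: form_ext_sum_list)
qed

lemma tensor_eq2_pairing:
  assumes "tensor_eq2 scale xs ys" and \<phi>: "bilinear_form scale \<phi>"
  shows "pairing2 xs \<phi> = pairing2 ys \<phi>"
proof -
  define \<psi> where "\<psi> w = (case w of [a, b] \<Rightarrow> \<phi> a b | _ \<Rightarrow> 0)" for w
  have "pairing2 zs \<phi> = sum_list (map \<psi> (map (\<lambda>(a, b). [a, b]) zs))" for zs
    by (induction zs) (auto simp: \<psi>_def)
  moreover have "sum_list (map \<psi> (map (\<lambda>(a, b). [a, b]) xs)) =
      sum_list (map \<psi> (map (\<lambda>(a, b). [a, b]) ys))"
  proof (rule form_ext_tensor_eq[OF assms(1)[unfolded tensor_eq2_def]])
    fix x y :: "'b list" and a b :: 'b and c :: 'a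
    show "\<psi> (x @ (a + b) # y) = \<psi> (x @ a # y) + \<psi> (x @ b # y)"
      using \<phi> unfolding \<psi>_def bilinear_form_def linear_form_iff
      by (auto simp: append_eq_Cons_conv Cons_eq_append_conv split: list.splits)
    show "\<psi> (x @ scale c a # y) = c * \<psi> (x @ a # y)"
      using \<phi> unfolding \<psi>_def bilinear_form_def linear_form_iff
      by (auto simp: append_eq_Cons_conv Cons_eq_append_conv split: list.splits)
  qed
  ultimately show ?thesis by simp
qed

lemma tensor_eq3_pairing:
  assumes "tensor_eq3 scale xs ys" and \<phi>: "trilinear_form scale \<phi>"
  shows "pairing3 xs \<phi> = pairing3 ys \<phi>"
proof -
  define \<psi> where "\<psi> w = (case w of [a, b, c] \<Rightarrow> \<phi> a b c | _ \<Rightarrow> 0)" for w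
  have "pairing3 zs \<phi> = sum_list (map \<psi> (map (\<lambda>(a, b, c). [a, b, c]) zs))" for zs
    by (induction zs) (auto simp: \<psi>_def)
  moreover have "sum_list (map \<psi> (map (\<lambda>(a, b, c). [a, b, c]) xs)) =
      sum_list (map \<psi> (map (\<lambda>(a, b, c). [a, b, c]) ys))"
  proof (rule form_ext_tensor_eq[OF assms(1)[unfolded tensor_eq3_def]])
    fix x y :: "'b list" and a b :: 'b and c :: 'a
    show "\<psi> (x @ (a + b) # y) = \<psi> (x @ a # y) + \<psi> (x @ b # y)"
      using \<phi> unfolding \<psi>_def trilinear_form_def bilinear_form_def linear_form_iff
      by (auto simp: append_eq_Cons_conv Cons_eq_append_conv split: list.splits)
    show "\<psi> (x @ scale c a # y) = c * \<psi> (x @ a # y)"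
      using \<phi> unfolding \<psi>_def trilinear_form_def bilinear_form_def linear_form_iff
      by (auto simp: append_eq_Cons_conv Cons_eq_append_conv split: list.splits)
  qed
  ultimately show ?thesis by simp
qed

end

section \<open>The antipode\<close>

lemma pairing3_concat_left:
  "pairing3 [(x\<^sub>1, x\<^sub>2, y). (x, y) \<leftarrow> xs, (x\<^sub>1, x\<^sub>2) \<leftarrow> f x] \<phi> =
     pairing2 xs (\<lambda>x y. pairing2 (f x) (\<lambda>x\<^sub>1 x\<^sub>2. \<phi> x\<^sub>1 x\<^sub>2 y))"
proof (induction xs)
  case (Cons p xs)
  then show ?case by (simp add: split_beta pairing3_map2)
qed simp

lemma pairing3_concat_right:
  "pairing3 [(x, y\<^sub>1, y\<^sub>2). (x, y) \<leftarrow> xs, (y\<^sub>1, y\<^sub>2) \<leftarrow> f y] \<phi> =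
     pairing2 xs (\<lambda>x y. pairing2 (f y) (\<lambda>y\<^sub>1 y\<^sub>2. \<phi> x y\<^sub>1 y\<^sub>2))"
proof (induction xs)
  case (Cons p xs)
  then show ?case by (simp add: split_beta pairing3_map2)
qed simp

lemma additive_sum_list_pairs:
  fixes F :: "'a::ab_group_add \<Rightarrow> 'k::field"
  assumes "\<And>x y. F (x + y) = F x + F y"
  shows "F (\<Sum>(x, y)\<leftarrow>xs. g x y) = pairing2 xs (\<lambda>x y. F (g x y))"
proof -
  have "F 0 = 0"
    using assms[of 0 0] by (metis add.right_neutral add_left_cancel)
  then show ?thesis
    by (induction xs) (auto simp: assms)
qed

context hopf_algebra
begin

lemma antipode_simps:
  "antipode (x + y) = antipode x + antipode y"
  "antipode (scale c x) = scale c (antipode x)"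
  using antipode_linear by (auto simp: Vector_Spaces.linear_iff)

lemma counit_simps:
  "counit (x + y) = counit x + counit y"
  "counit (scale c x) = c * counit x"
  using counit_linear by (auto simp: Vector_Spaces.linear_iff)

text \<open>
  With these rules the simplifier checks that an expression built from forms, products, antipode,
  counit and pairings is multilinear.
\<close>

lemmas multilinear_simps =
  bilinear_form_def trilinear_form_def linear_form_iff pairing2_add pairing2_mult_left
  distrib_left distrib_right mult_scale_left mult_scale_right antipode_simps counit_simps
  mult.left_commute

lemma pairing2_comult_mult:
  assumes "bilinear_form scale \<phi>"
  shows "pairing2 (comult (a * b)) \<phi> =
    pairing2 (comult a) (\<lambda>a\<^sub>1 a\<^sub>2. pairing2 (comult b) (\<lambda>b\<^sub>1 b\<^sub>2. \<phi> (a\<^sub>1 * b\<^sub>1) (a\<^sub>2 * b\<^sub>2)))"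
  using tensor_eq2_pairing[OF comult_mult assms] by (simp add: pairing2_tmult2)

lemma pairing2_coassoc:
  assumes "trilinear_form scale \<phi>"
  shows "pairing2 (comult a) (\<lambda>x y. pairing2 (comult x) (\<lambda>x\<^sub>1 x\<^sub>2. \<phi> x\<^sub>1 x\<^sub>2 y)) =
    pairing2 (comult a) (\<lambda>x y. pairing2 (comult y) (\<phi> x))"
  using tensor_eq3_pairing[OF coassoc assms]
  by (simp only: pairing3_concat_left pairing3_concat_right)

lemma pairing2_counit_left:
  assumes "Vector_Spaces.linear scale (*) f"
  shows "pairing2 (comult a) (\<lambda>x y. counit x * f y) = f a"
  using additive_sum_list_pairs[of f "\<lambda>x y. scale (counit x) y" "comult a"] assms
  by (simp add: counit_left linear_form_iff)

lemma pairing2_counit_right: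
  assumes "Vector_Spaces.linear scale (*) f"
  shows "pairing2 (comult a) (\<lambda>x y. counit y * f x) = f a"
  using additive_sum_list_pairs[of f "\<lambda>x y. scale (counit y) x" "comult a"] assms
  by (simp add: counit_right linear_form_iff)

lemma pairing2_antipode_left:
  assumes "Vector_Spaces.linear scale (*) f"
  shows "pairing2 (comult a) (\<lambda>x y. f (u * (antipode x * y) * w)) = counit a * f (u * w)"
  using additive_sum_list_pairs[of "\<lambda>z. f (u * z * w)" "\<lambda>x y. antipode x * y" "comult a"] assms
  by (simp add: antipode_left multilinear_simps)

lemma pairing2_antipode_right:
  assumes "Vector_Spaces.linear scale (*) f"
  shows "pairing2 (comult a) (\<lambda>x y. f (u * (x * antipode y) * w)) = counit a * f (u * w)"
  using additive_sum_list_pairs[of "\<lambda>z. f (u * z * w)" "\<lambda>x y. x * antipode y" "comult a"] assms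
  by (simp add: antipode_right multilinear_simps)

lemma form_antipode_one:
  assumes f: "Vector_Spaces.linear scale (*) f"
  shows "f (antipode 1) = f 1"
proof -
  have "bilinear_form scale (\<lambda>x y. f (antipode x * y))"
    using f by (simp add: multilinear_simps)
  from tensor_eq2_pairing[OF comult_one this]
  have "pairing2 (comult 1) (\<lambda>x y. f (antipode x * y)) = f (antipode 1)"
    by simp
  then show ?thesis
    using pairing2_antipode_left[OF f, of 1 1 1] by (simp add: counit_one)
qed

text \<open>
  The element \<open>\<Sum> s(b\<^sub>1) s(a\<^sub>1) a\<^sub>2 b\<^sub>2 s(a\<^sub>3 b\<^sub>3)\<close> is evaluated in two ways. Contracting
  \<open>a\<^sub>2 b\<^sub>2 s(a\<^sub>3 b\<^sub>3)\<close>, which is the product with the antipode on the coproduct of \<open>ab\<close>, leaves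
  \<open>s(b) s(a)\<close>; contracting \<open>s(a\<^sub>1) a\<^sub>2\<close> and then \<open>s(b\<^sub>1) b\<^sub>2\<close> leaves \<open>s(ab)\<close>.
\<close>

lemma form_antipode_mult:
  assumes f: "Vector_Spaces.linear scale (*) f"
  shows "f (antipode (a * b)) = f (antipode b * antipode a)"
proof -
  let ?D = "\<lambda>a. pairing2 (comult a)"
  let ?F = "\<lambda>a\<^sub>1 a\<^sub>2 a\<^sub>3 b\<^sub>1 b\<^sub>2 b\<^sub>3. f (antipode b\<^sub>1 * antipode a\<^sub>1 * (a\<^sub>2 * b\<^sub>2) * antipode (a\<^sub>3 * b\<^sub>3))"
  have "?D a (\<lambda>a\<^sub>1 a'. ?D a' (\<lambda>a\<^sub>2 a\<^sub>3. ?D b (\<lambda>b\<^sub>1 b'. ?D b' (?F a\<^sub>1 a\<^sub>2 a\<^sub>3 b\<^sub>1)))) =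
      f (antipode b * antipode a)"
  proof -
    have inner: "?D a' (\<lambda>a\<^sub>2 a\<^sub>3. ?D b' (?F a\<^sub>1 a\<^sub>2 a\<^sub>3 b\<^sub>1)) =
        counit a' * (counit b' * f (antipode b\<^sub>1 * antipode a\<^sub>1))" for a\<^sub>1 a' b\<^sub>1 b'
    proof -
      have "bilinear_form scale (\<lambda>x y. f (antipode b\<^sub>1 * antipode a\<^sub>1 * x * antipode y))"
        using f by (simp add: multilinear_simps)
      from pairing2_comult_mult[OF this, of a' b', symmetric] show ?thesis
        using pairing2_antipode_right[OF f, of "a' * b'" "antipode b\<^sub>1 * antipode a\<^sub>1" 1]
        by (simp add: mult.assoc counit_mult)
    qed
    have "?D a (\<lambda>a\<^sub>1 a'. ?D a' (\<lambda>a\<^sub>2 a\<^sub>3. ?D b (\<lambda>b\<^sub>1 b'. ?D b' (?F a\<^sub>1 a\<^sub>2 a\<^sub>3 b\<^sub>1)))) =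
        ?D a (\<lambda>a\<^sub>1 a'. ?D b (\<lambda>b\<^sub>1 b'. ?D a' (\<lambda>a\<^sub>2 a\<^sub>3. ?D b' (?F a\<^sub>1 a\<^sub>2 a\<^sub>3 b\<^sub>1))))"
      by (subst pairing2_swap) (rule HOL.refl)
    also have "\<dots> = ?D a (\<lambda>a\<^sub>1 a'. counit a' * ?D b (\<lambda>b\<^sub>1 b'. counit b' * f (antipode b\<^sub>1 * antipode a\<^sub>1)))"
      by (simp only: inner pairing2_mult_left)
    also have "\<dots> = ?D a (\<lambda>a\<^sub>1 a'. counit a' * f (antipode b * antipode a\<^sub>1))"
      using f by (subst pairing2_counit_right) (simp_all add: multilinear_simps)
    also have "\<dots> = f (antipode b * antipode a)"
      using f by (subst pairing2_counit_right) (simp_all add: multilinear_simps)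
    finally show ?thesis .
  qed
  moreover have "?D a (\<lambda>a\<^sub>1 a'. ?D a' (\<lambda>a\<^sub>2 a\<^sub>3. ?D b (\<lambda>b\<^sub>1 b'. ?D b' (?F a\<^sub>1 a\<^sub>2 a\<^sub>3 b\<^sub>1)))) =
      f (antipode (a * b))"
  proof -
    have tri_b: "trilinear_form scale (?F a\<^sub>1 a\<^sub>2 a\<^sub>3)" for a\<^sub>1 a\<^sub>2 a\<^sub>3
      using f by (simp add: multilinear_simps)
    have tri_a: "trilinear_form scale (\<lambda>a\<^sub>1 a\<^sub>2 a\<^sub>3. ?D b (\<lambda>b' b\<^sub>3. ?D b' (\<lambda>b\<^sub>1 b\<^sub>2. ?F a\<^sub>1 a\<^sub>2 a\<^sub>3 b\<^sub>1 b\<^sub>2 b\<^sub>3)))"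
      using f by (simp add: multilinear_simps)
    have "?D a (\<lambda>a\<^sub>1 a'. ?D a' (\<lambda>a\<^sub>2 a\<^sub>3. ?D b (\<lambda>b\<^sub>1 b'. ?D b' (?F a\<^sub>1 a\<^sub>2 a\<^sub>3 b\<^sub>1)))) =
        ?D a (\<lambda>a\<^sub>1 a'. ?D a' (\<lambda>a\<^sub>2 a\<^sub>3. ?D b (\<lambda>b' b\<^sub>3. ?D b' (\<lambda>b\<^sub>1 b\<^sub>2. ?F a\<^sub>1 a\<^sub>2 a\<^sub>3 b\<^sub>1 b\<^sub>2 b\<^sub>3))))"
      by (simp only: pairing2_coassoc[OF tri_b])
    also have "\<dots> = ?D a (\<lambda>a' a\<^sub>3. ?D a' (\<lambda>a\<^sub>1 a\<^sub>2. ?D b (\<lambda>b' b\<^sub>3. ?D b' (\<lambda>b\<^sub>1 b\<^sub>2. ?F a\<^sub>1 a\<^sub>2 a\<^sub>3 b\<^sub>1 b\<^sub>2 b\<^sub>3))))"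
      by (rule pairing2_coassoc[OF tri_a, symmetric])
    also have "\<dots> = ?D a (\<lambda>a' a\<^sub>3. ?D b (\<lambda>b' b\<^sub>3. ?D b' (\<lambda>b\<^sub>1 b\<^sub>2. ?D a' (\<lambda>a\<^sub>1 a\<^sub>2. ?F a\<^sub>1 a\<^sub>2 a\<^sub>3 b\<^sub>1 b\<^sub>2 b\<^sub>3))))"
      by (subst pairing2_swap, subst (2) pairing2_swap) (rule HOL.refl)
    also have "\<dots> = ?D a (\<lambda>a' a\<^sub>3. ?D b (\<lambda>b' b\<^sub>3. ?D b' (\<lambda>b\<^sub>1 b\<^sub>2. counit a' * f (antipode b\<^sub>1 * b\<^sub>2 * antipode (a\<^sub>3 * b\<^sub>3)))))"
    proof -
      have "?D a' (\<lambda>a\<^sub>1 a\<^sub>2. ?F a\<^sub>1 a\<^sub>2 a\<^sub>3 b\<^sub>1 b\<^sub>2 b\<^sub>3) = counit a' * f (antipode b\<^sub>1 * b\<^sub>2 * antipode (a\<^sub>3 * b\<^sub>3))"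
        for a' a\<^sub>3 b\<^sub>1 b\<^sub>2 b\<^sub>3
        using pairing2_antipode_left[OF f, of a' "antipode b\<^sub>1" "b\<^sub>2 * antipode (a\<^sub>3 * b\<^sub>3)"]
        by (simp add: mult.assoc)
      then show ?thesis by (simp only:)
    qed
    also have "\<dots> = ?D a (\<lambda>a' a\<^sub>3. counit a' * ?D b (\<lambda>b' b\<^sub>3. counit b' * f (antipode (a\<^sub>3 * b\<^sub>3))))"
      using pairing2_antipode_left[OF f, of _ 1] by (simp add: pairing2_mult_left)
    also have "\<dots> = ?D a (\<lambda>a' a\<^sub>3. counit a' * f (antipode (a\<^sub>3 * b)))"
      using f by (subst pairing2_counit_left) (simp_all add: multilinear_simps)
    also have "\<dots> = f (antipode (a * b))"
      using f by (subst pairing2_counit_left) (simp_all add: multilinear_simps)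
    finally show ?thesis .
  qed
  ultimately show ?thesis by simp
qed

end

section \<open>The universal R-matrix\<close>

context quasitriangular_hopf_algebra
begin

lemma pairing_R_Rinv:
  "bilinear_form scale \<phi> \<Longrightarrow> pairing2 R (\<lambda>a b. pairing2 Rinv (\<lambda>c d. \<phi> (a * c) (b * d))) = \<phi> 1 1"
  using tensor_eq2_pairing[OF R_Rinv] by (simp add: pairing2_tmult2)

lemma pairing_Rinv_R:
  "bilinear_form scale \<phi> \<Longrightarrow> pairing2 Rinv (\<lambda>a b. pairing2 R (\<lambda>c d. \<phi> (a * c) (b * d))) = \<phi> 1 1"
  using tensor_eq2_pairing[OF Rinv_R] by (simp add: pairing2_tmult2)

lemma pairing_R_comult:
  "bilinear_form scale \<phi> \<Longrightarrow>
    pairing2 R (\<lambda>e e'. pairing2 (comult a) (\<lambda>x y. \<phi> (e * x) (e' * y))) =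
    pairing2 (comult a) (\<lambda>x y. pairing2 R (\<lambda>e e'. \<phi> (y * e) (x * e')))"
  using tensor_eq2_pairing[OF R_comult] by (simp add: pairing2_tmult2 pairing2_flip2)

lemma pairing_comult_id_R:
  "trilinear_form scale \<phi> \<Longrightarrow>
    pairing2 R (\<lambda>e e'. pairing2 (comult e) (\<lambda>x y. \<phi> x y e')) =
    pairing2 R (\<lambda>a a'. pairing2 R (\<lambda>b b'. \<phi> a b (a' * b')))"
  using tensor_eq3_pairing[OF comult_id_R, unfolded pairing3_concat_left]
  by (simp add: pairing3_tmult3 pairing3_map2 split_beta)

lemma pairing_id_comult_R:
  "trilinear_form scale \<phi> \<Longrightarrow>
    pairing2 R (\<lambda>e e'. pairing2 (comult e') (\<phi> e)) =
    pairing2 R (\<lambda>a a'. pairing2 R (\<lambda>b b'. \<phi> (a * b) b' a'))"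
  using tensor_eq3_pairing[OF id_comult_R, unfolded pairing3_concat_right]
  by (simp add: pairing3_tmult3 pairing3_map2 split_beta)

text \<open>
  Applying \<open>\<epsilon>\<close> to the first leg of \<open>(\<Delta> \<otimes> id) \<rho> = \<rho>\<^sub>1\<^sub>3 \<rho>\<^sub>2\<^sub>3\<close> gives \<open>\<rho> = (1 \<otimes> u) \<rho>\<close> with
  \<open>u = (\<epsilon> \<otimes> id) \<rho>\<close>; as \<open>\<rho>\<close> is invertible, \<open>u = 1\<close>. The next lemma is the mirror image.
\<close>

lemma pairing_counit_id_R:
  assumes f: "Vector_Spaces.linear scale (*) f"
  shows "pairing2 R (\<lambda>e e'. counit e * f e') = f 1"
proof -
  let ?g = "\<lambda>x y. pairing2 Rinv (\<lambda>c c'. counit (x * c) * f (y * c'))"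
  have g: "bilinear_form scale ?g"
    using f by (simp add: multilinear_simps mult.assoc)
  have "f 1 = pairing2 R ?g"
    using pairing_R_Rinv[of "\<lambda>x y. counit x * f y"] f by (simp add: multilinear_simps counit_one)
  also have "\<dots> = pairing2 R (\<lambda>e e'. pairing2 (comult e) (\<lambda>x y. counit x * ?g y e'))"
    using g by (subst pairing2_counit_left) (simp_all add: multilinear_simps)
  also have "\<dots> = pairing2 R (\<lambda>a a'. pairing2 R (\<lambda>b b'. counit a * ?g b (a' * b')))"
    using g by (subst pairing_comult_id_R) (simp_all add: multilinear_simps)
  also have "\<dots> = pairing2 R (\<lambda>a a'. counit a * f a')"
  proof -
    have "pairing2 R (\<lambda>b b'. ?g b (a' * b')) = f a'" for a'
      using pairing_R_Rinv[of "\<lambda>x y. counit x * f (a' * y)"] f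
      by (simp add: multilinear_simps counit_one mult.assoc)
    then show ?thesis by (simp add: pairing2_mult_left)
  qed
  finally show ?thesis ..
qed

lemma pairing_id_counit_R:
  assumes f: "Vector_Spaces.linear scale (*) f"
  shows "pairing2 R (\<lambda>e e'. counit e' * f e) = f 1"
proof -
  let ?g = "\<lambda>x y. pairing2 Rinv (\<lambda>c c'. counit (y * c') * f (x * c))"
  have g: "bilinear_form scale ?g"
    using f by (simp add: multilinear_simps mult.assoc)
  have "f 1 = pairing2 R ?g"
    using pairing_R_Rinv[of "\<lambda>x y. counit y * f x"] f by (simp add: multilinear_simps counit_one)
  also have "\<dots> = pairing2 R (\<lambda>e e'. pairing2 (comult e') (\<lambda>x y. counit y * ?g e x))"
    using g by (subst pairing2_counit_right) (simp_all add: multilinear_simps)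
  also have "\<dots> = pairing2 R (\<lambda>a a'. pairing2 R (\<lambda>b b'. counit a' * ?g (a * b) b'))"
    using g by (subst pairing_id_comult_R) (simp_all add: multilinear_simps)
  also have "\<dots> = pairing2 R (\<lambda>a a'. counit a' * f a)"
  proof -
    have "pairing2 R (\<lambda>b b'. ?g (a * b) b') = f a" for a
      using pairing_R_Rinv[of "\<lambda>x y. counit y * f (a * x)"] f
      by (simp add: multilinear_simps counit_one mult.assoc)
    then show ?thesis by (simp add: pairing2_mult_left)
  qed
  finally show ?thesis ..
qed

text \<open>
  \<open>(s \<otimes> id) \<rho> = \<rho>\<^sup>-\<^sup>1\<close>: applying \<open>x \<otimes> y \<mapsto> s(x) y\<close> to the first two legs of
  \<open>(\<Delta> \<otimes> id) \<rho> = \<rho>\<^sub>1\<^sub>3 \<rho>\<^sub>2\<^sub>3\<close> shows that \<open>(s \<otimes> id) \<rho>\<close> is a left inverse of \<open>\<rho>\<close>.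
\<close>

lemma pairing_antipode_id_R:
  assumes \<phi>: "bilinear_form scale \<phi>"
  shows "pairing2 R (\<lambda>e e'. \<phi> (antipode e) e') = pairing2 Rinv \<phi>"
proof -
  \<comment> \<open>\<open>(s \<otimes> id) \<rho> \<cdot> \<rho> = 1 \<otimes> 1\<close>\<close>
  have left_inverse: "pairing2 R (\<lambda>a a'. pairing2 R (\<lambda>b b'. \<psi> (antipode a * b) (a' * b'))) = \<psi> 1 1"
    if \<psi>: "bilinear_form scale \<psi>" for \<psi>
  proof -
    have "pairing2 R (\<lambda>a a'. pairing2 R (\<lambda>b b'. \<psi> (antipode a * b) (a' * b'))) =
        pairing2 R (\<lambda>e e'. pairing2 (comult e) (\<lambda>x y. \<psi> (antipode x * y) e'))"
      using \<psi> by (subst pairing_comult_id_R) (simp_all add: multilinear_simps)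
    also have "\<dots> = pairing2 R (\<lambda>e e'. counit e * \<psi> 1 e')"
      using pairing2_antipode_left[of "\<lambda>x. \<psi> x _" _ 1 1] \<psi> by (simp add: bilinear_form_def)
    also have "\<dots> = \<psi> 1 1"
      using \<psi> by (subst pairing_counit_id_R) (simp_all add: bilinear_form_def)
    finally show ?thesis .
  qed
  have "pairing2 R (\<lambda>e e'. \<phi> (antipode e) e') =
      pairing2 R (\<lambda>a a'. pairing2 R (\<lambda>b b'. pairing2 Rinv (\<lambda>c c'. \<phi> (antipode a * (b * c)) (a' * (b' * c')))))"
    using pairing_R_Rinv[of "\<lambda>x y. \<phi> (antipode _ * x) (_ * y)"] \<phi> by (simp add: multilinear_simps)
  also have "\<dots> = pairing2 Rinv \<phi>"
    using left_inverse[of "\<lambda>x y. pairing2 Rinv (\<lambda>c c'. \<phi> (x * c) (y * c'))"] \<phi>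
    by (simp add: multilinear_simps mult.assoc)
  finally show ?thesis .
qed

text \<open>
  \<open>(s \<otimes> s) \<rho> = \<rho>\<close>: applying \<open>x \<otimes> y \<mapsto> s(x) y\<close> to the last two legs of \<open>(id \<otimes> \<Delta>) \<rho> = \<rho>\<^sub>1\<^sub>3 \<rho>\<^sub>1\<^sub>2\<close> gives
  \<open>\<Sum> a b \<otimes> s(b') a' = 1 \<otimes> 1\<close>, summed over two copies \<open>a \<otimes> a'\<close> and \<open>b \<otimes> b'\<close> of \<open>\<rho>\<close>. Applying the
  antihomomorphism \<open>s\<close> to the first leg turns this into \<open>(s \<otimes> s) \<rho> \<cdot> (s \<otimes> id) \<rho> = 1 \<otimes> 1\<close>, whose
  second factor is \<open>\<rho>\<^sup>-\<^sup>1\<close>.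
\<close>

lemma pairing_antipode_antipode_R:
  assumes \<phi>: "bilinear_form scale \<phi>"
  shows "pairing2 R (\<lambda>e e'. \<phi> (antipode e) (antipode e')) = pairing2 R \<phi>"
proof -
  \<comment> \<open>\<open>(s \<otimes> s) \<rho> \<cdot> \<rho>\<^sup>-\<^sup>1 = 1 \<otimes> 1\<close>\<close>
  have left_inverse:
    "pairing2 R (\<lambda>b b'. pairing2 Rinv (\<lambda>a a'. \<psi> (antipode b * a) (antipode b' * a'))) = \<psi> 1 1"
    if \<psi>: "bilinear_form scale \<psi>" for \<psi>
  proof -
    have lin: "Vector_Spaces.linear scale (*) (\<lambda>x. \<psi> x y)" "Vector_Spaces.linear scale (*) (\<psi> x)" for x y
      using \<psi> by (auto simp: bilinear_form_def)
    have "pairing2 R (\<lambda>b b'. pairing2 Rinv (\<lambda>a a'. \<psi> (antipode b * a) (antipode b' * a'))) =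
        pairing2 R (\<lambda>b b'. pairing2 R (\<lambda>a a'. \<psi> (antipode b * antipode a) (antipode b' * a')))"
      using \<psi> by (subst pairing_antipode_id_R[symmetric]) (simp_all add: multilinear_simps)
    also have "\<dots> = pairing2 R (\<lambda>a a'. pairing2 R (\<lambda>b b'. \<psi> (antipode (a * b)) (antipode b' * a')))"
      by (subst pairing2_swap) (simp only: form_antipode_mult[OF lin(1)])
    also have "\<dots> = pairing2 R (\<lambda>e e'. pairing2 (comult e') (\<lambda>x y. \<psi> (antipode e) (antipode x * y)))"
      using \<psi> by (subst pairing_id_comult_R) (simp_all add: multilinear_simps)
    also have "\<dots> = pairing2 R (\<lambda>e e'. counit e' * \<psi> (antipode e) 1)"
      using pairing2_antipode_left[OF lin(2), of _ _ 1 1] by simp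
    also have "\<dots> = \<psi> (antipode 1) 1"
      using \<psi> by (subst pairing_id_counit_R) (simp_all add: multilinear_simps)
    also have "\<dots> = \<psi> 1 1"
      by (rule form_antipode_one[OF lin(1)])
    finally show ?thesis .
  qed
  have "pairing2 R (\<lambda>e e'. \<phi> (antipode e) (antipode e')) =
      pairing2 R (\<lambda>a a'. pairing2 Rinv (\<lambda>b b'. pairing2 R (\<lambda>c c'. \<phi> (antipode a * (b * c)) (antipode a' * (b' * c')))))"
    using pairing_Rinv_R[of "\<lambda>x y. \<phi> (antipode _ * x) (antipode _ * y)"] \<phi> by (simp add: multilinear_simps)
  also have "\<dots> = pairing2 R \<phi>"
    using left_inverse[of "\<lambda>x y. pairing2 R (\<lambda>c c'. \<phi> (x * c) (y * c'))"] \<phi>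
    by (simp add: multilinear_simps mult.assoc)
  finally show ?thesis .
qed

text \<open>
  \<open>(id \<otimes> s) \<rho>\<^sup>-\<^sup>1 = (s \<otimes> s) \<rho> = \<rho>\<close>
\<close>

lemma pairing_id_antipode_Rinv:
  assumes \<phi>: "bilinear_form scale \<phi>"
  shows "pairing2 Rinv (\<lambda>e e'. \<phi> e (antipode e')) = pairing2 R \<phi>"
  using pairing_antipode_id_R[of "\<lambda>e e'. \<phi> e (antipode e')"] pairing_antipode_antipode_R[OF \<phi>] \<phi>
  by (simp add: multilinear_simps)

end

section \<open>The Yang-Baxter equation\<close>

lemma tmult3_simps:
  "tmult3 [] ys = []"
  "tmult3 ((a, b, c) # xs) ys = map (\<lambda>(d, e, f). (a * d, b * e, c * f)) ys @ tmult3 xs ys"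
  "tmult3 (xs @ xs') ys = tmult3 xs ys @ tmult3 xs' ys"
  by (simp_all add: tmult3_def)

lemma tmult3_assoc:
  fixes xs :: "('a::ring_1 \<times> 'a \<times> 'a) list"
  shows "tmult3 (tmult3 xs ys) zs = tmult3 xs (tmult3 ys zs)"
proof (induction xs)
  case (Cons p xs)
  obtain a b c where p: "p = (a, b, c)" by (cases p)
  have "tmult3 (map (\<lambda>(d, e, f). (a * d, b * e, c * f)) ys) zs =
      map (\<lambda>(d, e, f). (a * d, b * e, c * f)) (tmult3 ys zs)"
    by (induction ys) (auto simp: tmult3_simps mult.assoc split_beta)
  with Cons show ?case by (simp add: p tmult3_simps)
qed (simp add: tmult3_simps)

lemma tmult3_one [simp]:
  fixes xs :: "('a::ring_1 \<times> 'a \<times> 'a) list"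
  shows "tmult3 [(1, 1, 1)] xs = xs" "tmult3 xs [(1, 1, 1)] = xs"
  by (induction xs) (auto simp: tmult3_simps)

definition legs12 :: "('a \<times> 'a) list \<Rightarrow> ('a::ring_1 \<times> 'a \<times> 'a) list"
  where "legs12 xs = map (\<lambda>(a, b). (a, b, 1)) xs"

definition legs13 :: "('a \<times> 'a) list \<Rightarrow> ('a::ring_1 \<times> 'a \<times> 'a) list"
  where "legs13 xs = map (\<lambda>(a, b). (a, 1, b)) xs"

definition legs23 :: "('a \<times> 'a) list \<Rightarrow> ('a::ring_1 \<times> 'a \<times> 'a) list"
  where "legs23 xs = map (\<lambda>(a, b). (1, a, b)) xs"

lemma pairing3_legs:
  "pairing3 (legs12 xs) \<phi> = pairing2 xs (\<lambda>a b. \<phi> a b 1)"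
  "pairing3 (legs13 xs) \<phi> = pairing2 xs (\<lambda>a b. \<phi> a 1 b)"
  "pairing3 (legs23 xs) \<phi> = pairing2 xs (\<lambda>a b. \<phi> 1 a b)"
  by (simp_all add: legs12_def legs13_def legs23_def pairing3_map2)

lemma flip2_flip2 [simp]: "flip2 (flip2 xs) = xs"
  by (induction xs) (auto simp: flip2_def)

definition swap12 :: "('a \<times> 'a \<times> 'a) list \<Rightarrow> ('a \<times> 'a \<times> 'a) list"
  where "swap12 xs = map (\<lambda>(a, b, c). (b, a, c)) xs"

definition swap23 :: "('a \<times> 'a \<times> 'a) list \<Rightarrow> ('a \<times> 'a \<times> 'a) list"
  where "swap23 xs = map (\<lambda>(a, b, c). (a, c, b)) xs"

lemma swap_legs:
  "swap12 (legs12 xs) = legs12 (flip2 xs)" "swap12 (legs13 xs) = legs23 xs" "swap12 (legs23 xs) = legs13 xs"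
  "swap23 (legs12 xs) = legs13 xs" "swap23 (legs13 xs) = legs12 xs" "swap23 (legs23 xs) = legs23 (flip2 xs)"
  by (induction xs) (auto simp: swap12_def swap23_def legs12_def legs13_def legs23_def flip2_def)

lemma swap_tmult3:
  "swap12 (tmult3 xs ys) = tmult3 (swap12 xs) (swap12 ys)"
  "swap23 (tmult3 xs ys) = tmult3 (swap23 xs) (swap23 ys)"
  by (induction xs) (auto simp: swap12_def swap23_def tmult3_simps)

lemma pairing3_swap:
  "pairing3 (swap12 xs) \<phi> = pairing3 xs (\<lambda>a b c. \<phi> b a c)"
  "pairing3 (swap23 xs) \<phi> = pairing3 xs (\<lambda>a b c. \<phi> a c b)"
  by (induction xs) (auto simp: swap12_def swap23_def)

context hopf_algebra
begin

definition mutually_inverse2 :: "('a \<times> 'a) list \<Rightarrow> ('a \<times> 'a) list \<Rightarrow> bool"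
  where "mutually_inverse2 xs ys \<longleftrightarrow> (\<forall>\<phi>. bilinear_form scale \<phi> \<longrightarrow>
    pairing2 (tmult2 xs ys) \<phi> = \<phi> 1 1 \<and> pairing2 (tmult2 ys xs) \<phi> = \<phi> 1 1)"

definition same_pairing3 :: "('a \<times> 'a \<times> 'a) list \<Rightarrow> ('a \<times> 'a \<times> 'a) list \<Rightarrow> bool"
  where "same_pairing3 xs ys \<longleftrightarrow> (\<forall>\<phi>. trilinear_form scale \<phi> \<longrightarrow> pairing3 xs \<phi> = pairing3 ys \<phi>)"

lemma same_pairing3_refl: "same_pairing3 xs xs"
  and same_pairing3_sym: "same_pairing3 xs ys \<Longrightarrow> same_pairing3 ys xs"
  and same_pairing3_trans [trans]:
    "same_pairing3 xs ys \<Longrightarrow> same_pairing3 ys zs \<Longrightarrow> same_pairing3 xs zs"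
  by (auto simp: same_pairing3_def)

lemma same_pairing3_mult:
  assumes "same_pairing3 xs xs'" and "same_pairing3 ys ys'"
  shows "same_pairing3 (tmult3 xs ys) (tmult3 xs' ys')"
  unfolding same_pairing3_def
proof (intro allI impI)
  fix \<phi> :: "'a \<Rightarrow> 'a \<Rightarrow> 'a \<Rightarrow> 'k"
  assume \<phi>: "trilinear_form scale \<phi>"
  have "pairing3 ys (\<lambda>d e f. \<phi> (a * d) (b * e) (c * f)) = pairing3 ys' (\<lambda>d e f. \<phi> (a * d) (b * e) (c * f))"
    for a b c
    using assms(2) \<phi> by (simp add: same_pairing3_def multilinear_simps)
  moreover have "trilinear_form scale (\<lambda>a b c. pairing3 ys' (\<lambda>d e f. \<phi> (a * d) (b * e) (c * f)))"
    using \<phi> by (simp add: multilinear_simps pairing3_add pairing3_mult_left)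
  ultimately show "pairing3 (tmult3 xs ys) \<phi> = pairing3 (tmult3 xs' ys') \<phi>"
    using assms(1) by (simp add: pairing3_tmult3 same_pairing3_def)
qed

lemma same_pairing3_swap:
  assumes "same_pairing3 xs ys"
  shows "same_pairing3 (swap12 xs) (swap12 ys)" "same_pairing3 (swap23 xs) (swap23 ys)"
  using assms by (auto simp: same_pairing3_def pairing3_swap multilinear_simps)

lemma same_pairing3_cancel:
  assumes "same_pairing3 (tmult3 a u) (tmult3 w c)"
    and a: "same_pairing3 (tmult3 a' a) [(1, 1, 1)]" and c: "same_pairing3 (tmult3 c c') [(1, 1, 1)]"
  shows "same_pairing3 (tmult3 u c') (tmult3 a' w)"
proof -
  have "same_pairing3 (tmult3 u c') (tmult3 (tmult3 (tmult3 a' a) u) c')"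
    using same_pairing3_mult[OF same_pairing3_sym[OF a], of "tmult3 u c'" "tmult3 u c'"]
    by (simp add: tmult3_assoc same_pairing3_refl)
  also have "same_pairing3 \<dots> (tmult3 a' (tmult3 (tmult3 w c) c'))"
    using same_pairing3_mult[OF same_pairing3_refl same_pairing3_mult[OF assms(1) same_pairing3_refl], of a' c']
    by (simp add: tmult3_assoc)
  also have "same_pairing3 \<dots> (tmult3 a' w)"
    using same_pairing3_mult[OF same_pairing3_refl c, of "tmult3 a' w"]
    by (simp add: tmult3_assoc)
  finally show ?thesis .
qed

lemma legs_inverse:
  assumes "mutually_inverse2 xs ys"
  shows "same_pairing3 (tmult3 (legs12 xs) (legs12 ys)) [(1, 1, 1)]"
    and "same_pairing3 (tmult3 (legs13 xs) (legs13 ys)) [(1, 1, 1)]"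
    and "same_pairing3 (tmult3 (legs23 xs) (legs23 ys)) [(1, 1, 1)]"
proof -
  have inverse: "pairing2 xs (\<lambda>a b. pairing2 ys (\<lambda>c d. \<phi> (a * c) (b * d))) = \<phi> 1 1"
    if "bilinear_form scale \<phi>" for \<phi>
    using assms that by (simp add: mutually_inverse2_def pairing2_tmult2)
  have "pairing2 xs (\<lambda>a b. pairing2 ys (\<lambda>c d. \<phi> (a * c) (b * d) 1)) = \<phi> 1 1 1"
    "pairing2 xs (\<lambda>a b. pairing2 ys (\<lambda>c d. \<phi> (a * c) 1 (b * d))) = \<phi> 1 1 1"
    "pairing2 xs (\<lambda>a b. pairing2 ys (\<lambda>c d. \<phi> 1 (a * c) (b * d))) = \<phi> 1 1 1"
    if "trilinear_form scale \<phi>" for \<phi>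
    using that inverse[of "\<lambda>a b. \<phi> a b 1"] inverse[of "\<lambda>a b. \<phi> a 1 b"] inverse[of "\<lambda>a b. \<phi> 1 a b"]
    by (auto simp: trilinear_form_def bilinear_form_def)
  then show
    "same_pairing3 (tmult3 (legs12 xs) (legs12 ys)) [(1, 1, 1)]"
    "same_pairing3 (tmult3 (legs13 xs) (legs13 ys)) [(1, 1, 1)]"
    "same_pairing3 (tmult3 (legs23 xs) (legs23 ys)) [(1, 1, 1)]"
    by (simp_all add: same_pairing3_def pairing3_legs pairing3_tmult3)
qed

lemma inverse_mult:
  assumes "same_pairing3 (tmult3 a' a) [(1, 1, 1)]" and "same_pairing3 (tmult3 b' b) [(1, 1, 1)]"
  shows "same_pairing3 (tmult3 (tmult3 b' a') (tmult3 a b)) [(1, 1, 1)]"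
proof -
  have "same_pairing3 (tmult3 b' (tmult3 (tmult3 a' a) b)) (tmult3 b' (tmult3 [(1, 1, 1)] b))"
    by (intro same_pairing3_mult same_pairing3_refl assms)
  also have "same_pairing3 \<dots> [(1, 1, 1)]"
    using assms by simp
  finally show ?thesis by (simp add: tmult3_assoc)
qed

lemma mutually_inverse2_sym: "mutually_inverse2 xs ys \<Longrightarrow> mutually_inverse2 ys xs"
  by (auto simp: mutually_inverse2_def)

lemma mutually_inverse2_flip2:
  "mutually_inverse2 xs ys \<Longrightarrow> mutually_inverse2 (flip2 xs) (flip2 ys)"
  by (auto simp: mutually_inverse2_def pairing2_tmult2 pairing2_flip2 bilinear_form_def)

end

context quasitriangular_hopf_algebra
begin

lemma R_inverse: "mutually_inverse2 R Rinv"
  by (simp add: mutually_inverse2_def pairing2_tmult2 pairing_R_Rinv pairing_Rinv_R)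

text \<open>
  \<open>\<rho>\<^sub>1\<^sub>2 (\<rho>\<^sub>1\<^sub>3 \<rho>\<^sub>2\<^sub>3) = \<rho>\<^sub>1\<^sub>2 (\<Delta> \<otimes> id) \<rho> = (\<Delta>\<^sup>o\<^sup>p \<otimes> id) \<rho> \<rho>\<^sub>1\<^sub>2 = (\<rho>\<^sub>2\<^sub>3 \<rho>\<^sub>1\<^sub>3) \<rho>\<^sub>1\<^sub>2\<close>
\<close>

lemma yang_baxter:
  "same_pairing3 (tmult3 (legs12 R) (tmult3 (legs13 R) (legs23 R)))
     (tmult3 (legs23 R) (tmult3 (legs13 R) (legs12 R)))"
  unfolding same_pairing3_def
proof (intro allI impI)
  fix \<phi> :: "'a \<Rightarrow> 'a \<Rightarrow> 'a \<Rightarrow> 'k"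
  assume \<phi>: "trilinear_form scale \<phi>"
  have "pairing3 (tmult3 (legs12 R) (tmult3 (legs13 R) (legs23 R))) \<phi> =
      pairing2 R (\<lambda>a a'. pairing2 R (\<lambda>b b'. pairing2 R (\<lambda>c c'. \<phi> (a * b) (a' * c) (b' * c'))))"
    by (simp add: pairing3_tmult3 pairing3_legs)
  also have "\<dots> = pairing2 R (\<lambda>a a'. pairing2 R (\<lambda>e e'. pairing2 (comult e) (\<lambda>x y. \<phi> (a * x) (a' * y) e')))"
    using \<phi> by (subst pairing_comult_id_R) (simp_all add: multilinear_simps)
  also have "\<dots> = pairing2 R (\<lambda>e e'. pairing2 R (\<lambda>a a'. pairing2 (comult e) (\<lambda>x y. \<phi> (a * x) (a' * y) e')))"
    by (rule pairing2_swap)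
  also have "\<dots> = pairing2 R (\<lambda>e e'. pairing2 (comult e) (\<lambda>x y. pairing2 R (\<lambda>a a'. \<phi> (y * a) (x * a') e')))"
    using \<phi> by (subst pairing_R_comult) (simp_all add: multilinear_simps)
  also have "\<dots> = pairing2 R (\<lambda>b b'. pairing2 R (\<lambda>c c'. pairing2 R (\<lambda>a a'. \<phi> (c * a) (b * a') (b' * c'))))"
    using \<phi> by (subst pairing_comult_id_R) (simp_all add: multilinear_simps)
  also have "\<dots> = pairing3 (tmult3 (legs23 R) (tmult3 (legs13 R) (legs12 R))) \<phi>"
    by (simp add: pairing3_tmult3 pairing3_legs)
  finally show "pairing3 (tmult3 (legs12 R) (tmult3 (legs13 R) (legs23 R))) \<phi> =
      pairing3 (tmult3 (legs23 R) (tmult3 (legs13 R) (legs12 R))) \<phi>" .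
qed

text \<open>
  The tensor whose first leg acts on the strand from lower left to upper right and whose second
  leg acts on the other strand. In the second case the left leg of \<open>\<rho>\<close> belongs to the strand
  on the right, since that one passes over.
\<close>

definition crossing_tensor :: "bool \<Rightarrow> ('a \<times> 'a) list"
  where "crossing_tensor b = (if b then R else flip2 Rinv)"

text \<open>
  The flip accounts for the exchange of the two strands by the first crossing.
\<close>

lemma crossing_tensor_inverse:
  "mutually_inverse2 (flip2 (crossing_tensor (\<not> b))) (crossing_tensor b)"
  using R_inverse mutually_inverse2_sym[OF R_inverse] by (auto simp: crossing_tensor_def mutually_inverse2_flip2)

text \<open>
  If strand \<open>i\<close> lies above \<open>j\<close> and \<open>j\<close> above \<open>k\<close>, the Yang-Baxter equation for \<open>\<rho>\<close> on the legs
  \<open>i\<close>, \<open>j\<close>, \<open>k\<close> holds. Where the order of heights differs from that of the strands, \<open>\<rho>\<^sub>j\<^sub>i\<close> has to be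
  replaced by the inverse that occurs in the crossing tensor, and cancelling it on both sides carries
  it to the other end of the product. The two cyclic patterns admit no such order.
\<close>

lemma yang_baxter_crossings:
  assumes "b\<^sub>1\<^sub>2 = b\<^sub>2\<^sub>3 \<longrightarrow> b\<^sub>1\<^sub>3 = b\<^sub>1\<^sub>2"
  shows "same_pairing3
    (tmult3 (legs23 (crossing_tensor b\<^sub>2\<^sub>3)) (tmult3 (legs13 (crossing_tensor b\<^sub>1\<^sub>3)) (legs12 (crossing_tensor b\<^sub>1\<^sub>2))))
    (tmult3 (legs12 (crossing_tensor b\<^sub>1\<^sub>2)) (tmult3 (legs13 (crossing_tensor b\<^sub>1\<^sub>3)) (legs23 (crossing_tensor b\<^sub>2\<^sub>3))))"
proof -
  let ?S = "flip2 R" and ?I = "flip2 Rinv"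
  have inv: "mutually_inverse2 ?S ?I" "mutually_inverse2 ?I ?S"
    using R_inverse by (auto intro: mutually_inverse2_flip2 mutually_inverse2_sym)
  note inv1 = inv[THEN legs_inverse(1)] inv[THEN legs_inverse(2)] inv[THEN legs_inverse(3)]
  note swaps = swap_tmult3 swap_legs flip2_flip2
  note ybe123 = yang_baxter
  note ybe132 = same_pairing3_swap(2)[OF ybe123, unfolded swaps]
  note ybe213 = same_pairing3_swap(1)[OF ybe123, unfolded swaps]
  note ybe231 = same_pairing3_swap(1)[OF ybe132, unfolded swaps]
  note ybe312 = same_pairing3_swap(2)[OF ybe213, unfolded swaps]
  note ybe321 = same_pairing3_swap(2)[OF ybe231, unfolded swaps]
  have ttf: "same_pairing3 (tmult3 (tmult3 (legs12 R) (legs13 R)) (legs23 ?I)) (tmult3 (legs23 ?I) (tmult3 (legs13 R) (legs12 R)))"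
    by (rule same_pairing3_cancel[where a = "legs23 ?S" and c = "legs23 ?S"],
        use same_pairing3_sym[OF ybe132] in \<open>simp add: tmult3_assoc\<close>, (intro inverse_mult inv1)+)
  have ftt: "same_pairing3 (tmult3 (tmult3 (legs23 R) (legs13 R)) (legs12 ?I)) (tmult3 (legs12 ?I) (tmult3 (legs13 R) (legs23 R)))"
    by (rule same_pairing3_cancel[where a = "legs12 ?S" and c = "legs12 ?S"],
        use ybe213 in \<open>simp add: tmult3_assoc\<close>, (intro inverse_mult inv1)+)
  have tff: "same_pairing3 (tmult3 (legs12 R) (tmult3 (legs13 ?I) (legs23 ?I))) (tmult3 (tmult3 (legs23 ?I) (legs13 ?I)) (legs12 R))"
    by (rule same_pairing3_cancel[where a = "tmult3 (legs13 ?S) (legs23 ?S)" and c = "tmult3 (legs23 ?S) (legs13 ?S)"],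
        use ybe312 in \<open>simp add: tmult3_assoc\<close>, (intro inverse_mult inv1)+)
  have fft: "same_pairing3 (tmult3 (legs23 R) (tmult3 (legs13 ?I) (legs12 ?I))) (tmult3 (tmult3 (legs12 ?I) (legs13 ?I)) (legs23 R))"
    by (rule same_pairing3_cancel[where a = "tmult3 (legs13 ?S) (legs12 ?S)" and c = "tmult3 (legs12 ?S) (legs13 ?S)"],
        use same_pairing3_sym[OF ybe231] in \<open>simp add: tmult3_assoc\<close>, (intro inverse_mult inv1)+)
  \<comment> \<open>no factor \<open>\<rho>\<close> stays in place here: the whole equation is inverted, with units as the remaining factors\<close>
  have fff: "same_pairing3
      (tmult3 [(1, 1, 1)] (tmult3 (legs23 ?I) (tmult3 (legs13 ?I) (legs12 ?I))))
      (tmult3 (tmult3 (tmult3 (legs12 ?I) (legs13 ?I)) (legs23 ?I)) [(1, 1, 1)])"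
  proof (rule same_pairing3_cancel)
    show "same_pairing3 (tmult3 (tmult3 (legs23 ?S) (tmult3 (legs13 ?S) (legs12 ?S))) [(1, 1, 1)])
        (tmult3 [(1, 1, 1)] (tmult3 (tmult3 (legs12 ?S) (legs13 ?S)) (legs23 ?S)))"
      using ybe321 by (simp add: tmult3_assoc)
  qed (intro inverse_mult inv1)+
  show ?thesis
    using assms same_pairing3_sym[OF ybe123] same_pairing3_sym[OF ttf] ftt same_pairing3_sym[OF tff] fft fff
    by (cases b\<^sub>1\<^sub>2; cases b\<^sub>1\<^sub>3; cases b\<^sub>2\<^sub>3) (simp_all add: crossing_tensor_def tmult3_assoc)
qed

end

section \<open>Matrices of cups, caps and crossings\<close>

context quasitriangular_hopf_algebra
begin

lemma pairing_crossing_tensor_antipode: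
  assumes "bilinear_form scale \<phi>"
  shows "pairing2 (crossing_tensor (\<not> b)) (\<lambda>a a'. \<phi> a' (antipode a)) =
    pairing2 (crossing_tensor b) \<phi>"
proof -
  have "bilinear_form scale (\<lambda>a b. \<phi> b a)"
    using assms by (simp add: bilinear_form_def)
  from pairing_antipode_id_R[OF this] pairing_id_antipode_Rinv[OF assms] show ?thesis
    by (cases b) (simp_all add: crossing_tensor_def pairing2_flip2)
qed

lemma pairing_crossing_tensor_antipode_antipode:
  assumes \<phi>: "bilinear_form scale \<phi>"
  shows "pairing2 (crossing_tensor b) (\<lambda>a a'. \<phi> (antipode a) (antipode a')) =
    pairing2 (crossing_tensor b) \<phi>"
proof -
  have antipode_left: "bilinear_form scale (\<lambda>a a'. \<phi> (antipode a) a')"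
    and both: "bilinear_form scale (\<lambda>a a'. \<phi> (antipode a) (antipode a'))"
    and flip: "bilinear_form scale (\<lambda>a a'. \<phi> a' a)"
    if "bilinear_form scale \<phi>" for \<phi>
    using that by (simp_all add: multilinear_simps)
  have "pairing2 Rinv (\<lambda>a a'. \<phi> (antipode a) (antipode a')) = pairing2 Rinv \<phi>"
    if \<phi>: "bilinear_form scale \<phi>" for \<phi>
    using pairing_antipode_id_R[OF both[OF \<phi>]] pairing_antipode_antipode_R[OF antipode_left[OF \<phi>]]
      pairing_antipode_id_R[OF \<phi>] by simp
  from this[OF flip[OF \<phi>]] pairing_antipode_antipode_R[OF \<phi>] show ?thesis
    by (cases b) (simp_all add: crossing_tensor_def pairing2_flip2)
qed

end

text \<open>
  The assumption on \<open>s\<^sup>2\<close> enters through the slides along left-to-right caps and cups below.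
\<close>

locale link_evaluation =
  H: quasitriangular_hopf_algebra scale comult counit antipode R Rinv +
  V: fin_dim_representation scale scaleV B act
  for scale :: "'k::field \<Rightarrow> 'a::ring_1 \<Rightarrow> 'a" and comult counit antipode R Rinv
    and scaleV :: "'k \<Rightarrow> 'v::ab_group_add \<Rightarrow> 'v" and B act +
  fixes G Ginv :: 'a
  assumes G_Ginv: "G * Ginv = 1"
    and Ginv_G: "Ginv * G = 1"
    and antipode_antipode: "antipode (antipode a) = Ginv * a * G"
begin

abbreviation coord :: "'v \<Rightarrow> 'v \<Rightarrow> 'k"
  where "coord \<equiv> dual_vector scaleV B"

lemma coord_linear: "Vector_Spaces.linear scaleV (*) (coord \<beta>)"
  unfolding V.linear_form_iff dual_vector_def
  by (simp add: V.representation_add V.representation_scale V.independent_Basis V.span_Basis)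

lemma coord_basis: "\<beta> \<in> B \<Longrightarrow> coord \<gamma> \<beta> = (if \<beta> = \<gamma> then 1 else 0)"
  by (auto simp: dual_vector_def V.representation_basis V.independent_Basis)

lemma linear_expand:
  assumes "Vector_Spaces.linear scaleV (*) f"
  shows "f x = (\<Sum>\<beta>\<in>B. coord \<beta> x * f \<beta>)"
proof -
  have add: "f (x + y) = f x + f y" and scale: "f (scaleV c x) = c * f x" for x y c
    using assms by (auto simp: V.linear_form_iff)
  have "f 0 = 0"
    using scale[of 0 0] by simp
  then have sum: "f (\<Sum>\<beta>\<in>A. g \<beta>) = (\<Sum>\<beta>\<in>A. f (g \<beta>))" for A and g :: "'v \<Rightarrow> 'v"
    by (induction A rule: infinite_finite_induct) (auto simp: add)
  have "x = (\<Sum>\<beta>\<in>B. scaleV (coord \<beta> x) \<beta>)"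
    unfolding dual_vector_def
    by (rule V.sum_representation_eq[symmetric])
      (auto simp: V.independent_Basis V.span_Basis V.finite_Basis)
  then have "f x = f (\<Sum>\<beta>\<in>B. scaleV (coord \<beta> x) \<beta>)"
    by simp
  then show ?thesis
    by (simp only: sum scale)
qed

lemma act_form_linear:
  assumes "Vector_Spaces.linear scaleV (*) f"
  shows "Vector_Spaces.linear scaleV (*) (\<lambda>x. f (act a x))"
    and "Vector_Spaces.linear scale (*) (\<lambda>a. f (act a x))"
proof -
  have "act a (x + y) = act a x + act a y" "act a (scaleV c x) = scaleV c (act a x)" for x y c
    using V.act_linear[of a] by (auto simp: Vector_Spaces.linear_iff)
  with assms show "Vector_Spaces.linear scaleV (*) (\<lambda>x. f (act a x))"
    "Vector_Spaces.linear scale (*) (\<lambda>a. f (act a x))"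
    by (auto simp: V.linear_form_iff H.linear_form_iff V.act_add V.act_scale)
qed

text \<open>
  A label \<open>\<beta>\<close> stands for \<open>\<beta>\<close> itself on an upward strand and for \<open>\<beta>\<^sup>*\<close> on a downward one, where \<open>a\<close>
  acts by \<open>f \<mapsto> f \<circ> s(a)\<close>; passing to the dual transposes the matrix.
\<close>

definition rep :: "orient \<Rightarrow> 'a \<Rightarrow> 'v \<Rightarrow> 'v \<Rightarrow> 'k"
  where "rep p a \<beta> \<gamma> = (case p of
    Up \<Rightarrow> coord \<gamma> (act a \<beta>) | Down \<Rightarrow> coord \<beta> (act (antipode a) \<gamma>))"

lemma rep_linear: "Vector_Spaces.linear scale (*) (\<lambda>a. rep p a \<beta> \<gamma>)"
  using act_form_linear(2)[OF coord_linear]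
  by (cases p) (simp_all add: rep_def H.multilinear_simps)

lemma rep_one:
  assumes "\<beta> \<in> B" and "\<gamma> \<in> B"
  shows "rep p 1 \<beta> \<gamma> = (if \<beta> = \<gamma> then 1 else 0)"
  using assms H.form_antipode_one[OF act_form_linear(2)[OF coord_linear]]
  by (cases p) (auto simp: rep_def V.act_one coord_basis)

lemma coord_act_mult: "coord \<gamma> (act (a * b) \<beta>) = (\<Sum>\<delta>\<in>B. coord \<delta> (act b \<beta>) * coord \<gamma> (act a \<delta>))"
  using linear_expand[OF act_form_linear(1)[OF coord_linear], of \<gamma> a "act b \<beta>"]
  by (simp add: V.act_mult)

lemma rep_mult: "rep p (a * b) \<beta> \<gamma> = (\<Sum>\<delta>\<in>B. rep p b \<beta> \<delta> * rep p a \<delta> \<gamma>)"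
proof (cases p)
  case Down
  then show ?thesis
    using H.form_antipode_mult[OF act_form_linear(2)[OF coord_linear], where a = a and b = b]
    by (simp add: rep_def coord_act_mult mult.commute)
qed (simp add: rep_def coord_act_mult)

lemma rep_bilinear: "bilinear_form scale (\<lambda>a b. rep p a \<beta> \<gamma> * rep q b \<beta>' \<gamma>')"
  using rep_linear unfolding bilinear_form_def H.linear_form_iff by (auto simp: algebra_simps)

lemma rep_trilinear:
  "trilinear_form scale (\<lambda>a b c. rep p a \<beta> \<gamma> * rep q b \<beta>' \<gamma>' * rep r c \<beta>'' \<gamma>'')"
  using rep_linear unfolding bilinear_form_def trilinear_form_def H.linear_form_iff
  by (auto simp: algebra_simps)

definition cap_entry :: "orient \<Rightarrow> 'v \<Rightarrow> 'v \<Rightarrow> 'k"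
  where "cap_entry p \<beta> \<gamma> = (case p of
    Up \<Rightarrow> coord \<gamma> (act Ginv \<beta>) | Down \<Rightarrow> if \<beta> = \<gamma> then 1 else 0)"

definition cup_entry :: "orient \<Rightarrow> 'v \<Rightarrow> 'v \<Rightarrow> 'k"
  where "cup_entry p \<beta> \<gamma> = (case p of
    Up \<Rightarrow> if \<beta> = \<gamma> then 1 else 0 | Down \<Rightarrow> coord \<gamma> (act G \<beta>))"

text \<open>
  \<open>i\<close> and \<open>j\<close> are the labels of the two lower ends, \<open>j'\<close> and \<open>i'\<close> those of the upper ends, each from
  left to right; the strand from \<open>i\<close> to \<open>i'\<close> is the one with lower left end.
\<close>

definition cross_entry :: "bool \<Rightarrow> orient \<Rightarrow> orient \<Rightarrow> 'v \<Rightarrow> 'v \<Rightarrow> 'v \<Rightarrow> 'v \<Rightarrow> 'k"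
  where "cross_entry b p q i j j' i' =
    pairing2 (H.crossing_tensor b) (\<lambda>a a'. rep p a i i' * rep q a' j j')"

lemma mult_delta:
  "(x::'k) * (if P then y else 0) = (if P then x * y else 0)"
  "(if P then y else 0) * (x::'k) = (if P then y * x else 0)"
  by simp_all

text \<open>
  For the left-to-right cap the two sides are \<open>f(G\<^sup>-\<^sup>1 a x)\<close> and \<open>f(s\<^sup>2(a) G\<^sup>-\<^sup>1 x)\<close>.
\<close>

lemma cap_slide:
  assumes "i \<in> B" and "k \<in> B"
  shows "(\<Sum>m\<in>B. rep p a i m * cap_entry p m k) =
    (\<Sum>m\<in>B. rep (opp p) (antipode a) k m * cap_entry p i m)"
proof (cases p)
  case Up
  have "antipode (antipode a) * Ginv = Ginv * a"
    by (simp add: antipode_antipode mult.assoc G_Ginv)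
  then show ?thesis
    using Up coord_act_mult[of k Ginv a i] coord_act_mult[of k "antipode (antipode a)" Ginv i]
    by (simp add: rep_def cap_entry_def mult.commute)
next
  case Down
  then show ?thesis
    using assms V.finite_Basis by (simp add: rep_def cap_entry_def mult_delta)
qed

text \<open>
  For the left-to-right cup the two sides compare \<open>G s\<^sup>2(a)\<close> with \<open>a G\<close>.
\<close>

lemma cup_slide:
  assumes "i \<in> B" and "k \<in> B"
  shows "(\<Sum>m\<in>B. cup_entry p m k * rep p (antipode a) m i) =
    (\<Sum>m\<in>B. cup_entry p i m * rep (opp p) a m k)"
proof (cases p)
  case Up
  then show ?thesis
    using assms V.finite_Basis by (simp add: rep_def cup_entry_def mult_delta)
next
  case Down
  have "G * antipode (antipode a) = a * G"
    by (simp add: antipode_antipode mult.assoc[symmetric] G_Ginv)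
  then show ?thesis
    using Down coord_act_mult[of k G "antipode (antipode a)" i] coord_act_mult[of k a G i]
    by (simp add: rep_def cup_entry_def mult.commute)
qed

lemma snake_left:
  assumes "i \<in> B" and "k \<in> B"
  shows "(\<Sum>m\<in>B. cup_entry (opp p) m k * cap_entry p i m) = (if i = k then 1 else 0)"
  using assms coord_act_mult[of k G Ginv i] V.finite_Basis
  by (cases p) (auto simp: cap_entry_def cup_entry_def G_Ginv V.act_one coord_basis mult_delta mult.commute)

lemma snake_right:
  assumes "i \<in> B" and "k \<in> B"
  shows "(\<Sum>m\<in>B. cup_entry p k m * cap_entry (opp p) m i) = (if i = k then 1 else 0)"
  using assms coord_act_mult[of i Ginv G k] V.finite_Basis
  by (cases p) (auto simp: cap_entry_def cup_entry_def Ginv_G V.act_one coord_basis mult_delta mult.commute)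

lemma pairing2_form_sum_left:
  "(\<Sum>m\<in>A. pairing2 xs (\<lambda>a a'. f a m * g a') * h m) = pairing2 xs (\<lambda>a a'. (\<Sum>m\<in>A. f a m * h m) * g a')"
  by (simp add: pairing2_sum sum_distrib_left sum_distrib_right pairing2_mult_right[symmetric] pairing2_mult_left[symmetric] mult_ac)

lemma pairing2_form_sum_right:
  "(\<Sum>m\<in>A. pairing2 xs (\<lambda>a a'. f a * g a' m) * h m) = pairing2 xs (\<lambda>a a'. f a * (\<Sum>m\<in>A. g a' m * h m))"
  by (simp add: pairing2_sum sum_distrib_left sum_distrib_right pairing2_mult_right[symmetric] pairing2_mult_left[symmetric] mult_ac)

text \<open>
  Sliding the first leg of the crossing tensor along the cap applies \<open>s\<close> to it, which gives the
  tensor of the opposite crossing.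
\<close>

lemma switchback_cap_entry:
  assumes B: "i \<in> B" "j \<in> B" "k \<in> B" "l \<in> B"
  shows "(\<Sum>m\<in>B. cross_entry b p q i j l m * cap_entry p m k) =
    (\<Sum>m\<in>B. cross_entry (\<not> b) q (opp p) j k m l * cap_entry p i m)"
proof -
  let ?g = "\<lambda>a. \<Sum>m\<in>B. rep (opp p) a k m * cap_entry p i m"
  have g: "Vector_Spaces.linear scale (*) ?g"
    using rep_linear unfolding H.linear_form_iff
    by (simp add: algebra_simps sum.distrib sum_distrib_left)
  have "(\<Sum>m\<in>B. cross_entry b p q i j l m * cap_entry p m k) =
      pairing2 (H.crossing_tensor b) (\<lambda>a a'. (\<Sum>m\<in>B. rep p a i m * cap_entry p m k) * rep q a' j l)"
    by (simp add: cross_entry_def pairing2_form_sum_left)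
  also have "\<dots> = pairing2 (H.crossing_tensor b) (\<lambda>a a'. ?g (antipode a) * rep q a' j l)"
    by (simp only: cap_slide[OF B(1,3)])
  also have "\<dots> = pairing2 (H.crossing_tensor (\<not> b)) (\<lambda>a a'. rep q a j l * ?g a')"
    using H.pairing_crossing_tensor_antipode[of "\<lambda>y x. ?g x * rep q y j l" "\<not> b"] g rep_linear
    by (simp add: bilinear_form_def H.linear_form_iff algebra_simps)
  also have "\<dots> = (\<Sum>m\<in>B. cross_entry (\<not> b) q (opp p) j k m l * cap_entry p i m)"
    by (simp add: cross_entry_def pairing2_form_sum_right)
  finally show ?thesis .
qed

lemma switchback_cup_entry:
  assumes B: "i \<in> B" "j \<in> B" "k \<in> B" "l \<in> B"
  shows "(\<Sum>m\<in>B. cup_entry p m k * cross_entry b q p j m i l) =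
    (\<Sum>m\<in>B. cup_entry p i m * cross_entry (\<not> b) (opp p) q m j l k)"
proof -
  let ?g = "\<lambda>a. \<Sum>m\<in>B. cup_entry p m k * rep p a m i"
  have g: "Vector_Spaces.linear scale (*) ?g"
    using rep_linear unfolding H.linear_form_iff
    by (simp add: algebra_simps sum.distrib sum_distrib_left)
  have "(\<Sum>m\<in>B. cup_entry p m k * cross_entry b q p j m i l) =
      pairing2 (H.crossing_tensor b) (\<lambda>a a'. rep q a j l * ?g a')"
    by (simp add: cross_entry_def pairing2_sum sum_distrib_left pairing2_mult_left[symmetric] mult_ac)
  also have "\<dots> = pairing2 (H.crossing_tensor (\<not> b)) (\<lambda>a a'. ?g (antipode a) * rep q a' j l)"
    using H.pairing_crossing_tensor_antipode[of "\<lambda>x y. rep q x j l * ?g y" b] g rep_linear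
    by (simp add: bilinear_form_def H.linear_form_iff algebra_simps)
  also have "\<dots> = (\<Sum>m\<in>B. cup_entry p i m * cross_entry (\<not> b) (opp p) q m j l k)"
    by (simp add: cup_slide[OF B(1,3)] cross_entry_def pairing2_sum sum_distrib_left sum_distrib_right
        pairing2_mult_left[symmetric] mult_ac)
  finally show ?thesis .
qed

lemma R2_entry:
  assumes B: "i \<in> B" "j \<in> B" "i' \<in> B" "j' \<in> B"
  shows "(\<Sum>l\<in>B. \<Sum>m\<in>B. cross_entry b p q i j l m * cross_entry (\<not> b) q p l m i' j') =
    (if i = i' \<and> j = j' then 1 else 0)"
proof -
  have "(if i = i' \<and> j = j' then 1 else 0) = rep p 1 i i' * rep q 1 j j'"
    using B by (simp add: rep_one)
  also have "\<dots> = pairing2 (tmult2 (flip2 (H.crossing_tensor (\<not> b))) (H.crossing_tensor b))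
      (\<lambda>a a'. rep p a i i' * rep q a' j j')"
    using H.crossing_tensor_inverse[of b] rep_bilinear by (simp add: H.mutually_inverse2_def)
  also have "\<dots> = pairing2 (H.crossing_tensor (\<not> b)) (\<lambda>c c'. pairing2 (H.crossing_tensor b) (\<lambda>a a'.
      \<Sum>l\<in>B. \<Sum>m\<in>B. (rep p a i m * rep q a' j l) * (rep q c l j' * rep p c' m i')))"
    by (simp add: pairing2_tmult2 pairing2_flip2 rep_mult sum_product mult_ac)
      (subst sum.swap, rule HOL.refl)
  also have "\<dots> = (\<Sum>l\<in>B. \<Sum>m\<in>B. cross_entry b p q i j l m * cross_entry (\<not> b) q p l m i' j')"
    by (simp add: cross_entry_def pairing2_sum pairing2_mult_right pairing2_mult_left)
  finally show ?thesis ..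
qed

lemma sum_product3:
  fixes f g h :: "'b \<Rightarrow> 'k"
  shows "(\<Sum>i\<in>A. f i) * (\<Sum>j\<in>A. g j) * (\<Sum>k\<in>A. h k) = (\<Sum>i\<in>A. \<Sum>j\<in>A. \<Sum>k\<in>A. f i * g j * h k)"
  by (simp add: sum_distrib_left[symmetric] sum_distrib_right[symmetric])

lemma pairing2_sum3:
  fixes f g h :: "'b \<Rightarrow> 'b \<Rightarrow> 'b \<Rightarrow> 'a \<Rightarrow> 'a \<Rightarrow> 'k"
  shows "pairing2 zs (\<lambda>e e'. pairing2 ys (\<lambda>c c'. pairing2 xs (\<lambda>a a'.
      \<Sum>i\<in>A. \<Sum>j\<in>A. \<Sum>k\<in>A. f i j k a a' * g i j k c c' * h i j k e e'))) =
    (\<Sum>i\<in>A. \<Sum>j\<in>A. \<Sum>k\<in>A. pairing2 xs (f i j k) * pairing2 ys (g i j k) * pairing2 zs (h i j k))"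
  by (simp add: pairing2_sum pairing2_mult_left pairing2_mult_right)

text \<open>
  Both sides are the value, on the product of the three crossing tensors in the two orders, of the
  trilinear form that takes the matrix entries from \<open>(i, j, k)\<close> to \<open>(i', j', k')\<close>.
\<close>

lemma R3_entry:
  assumes "b\<^sub>1\<^sub>2 = b\<^sub>2\<^sub>3 \<longrightarrow> b\<^sub>1\<^sub>3 = b\<^sub>1\<^sub>2"
  shows "(\<Sum>i1\<in>B. \<Sum>j1\<in>B. \<Sum>k1\<in>B. cross_entry b\<^sub>1\<^sub>2 p q i j j1 i1 *
      cross_entry b\<^sub>1\<^sub>3 p r i1 k k1 i' * cross_entry b\<^sub>2\<^sub>3 q r j1 k1 k' j') =
    (\<Sum>i1\<in>B. \<Sum>j1\<in>B. \<Sum>k1\<in>B. cross_entry b\<^sub>2\<^sub>3 q r j k k1 j1 *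
      cross_entry b\<^sub>1\<^sub>3 p r i k1 k' i1 * cross_entry b\<^sub>1\<^sub>2 p q i1 j1 j' i')"
proof -
  let ?X = "H.crossing_tensor"
  let ?\<phi> = "\<lambda>a b c. rep p a i i' * rep q b j j' * rep r c k k'"
  have "(\<Sum>i1\<in>B. \<Sum>j1\<in>B. \<Sum>k1\<in>B. cross_entry b\<^sub>1\<^sub>2 p q i j j1 i1 *
      cross_entry b\<^sub>1\<^sub>3 p r i1 k k1 i' * cross_entry b\<^sub>2\<^sub>3 q r j1 k1 k' j') =
      pairing2 (?X b\<^sub>2\<^sub>3) (\<lambda>e e'. pairing2 (?X b\<^sub>1\<^sub>3) (\<lambda>c c'. pairing2 (?X b\<^sub>1\<^sub>2) (\<lambda>a a'.
        \<Sum>i1\<in>B. \<Sum>j1\<in>B. \<Sum>k1\<in>B. (rep p a i i1 * rep q a' j j1) *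
          (rep p c i1 i' * rep r c' k k1) * (rep q e j1 j' * rep r e' k1 k'))))"
    by (simp only: pairing2_sum3 cross_entry_def)
  also have "\<dots> = pairing3 (tmult3 (legs23 (?X b\<^sub>2\<^sub>3)) (tmult3 (legs13 (?X b\<^sub>1\<^sub>3)) (legs12 (?X b\<^sub>1\<^sub>2)))) ?\<phi>"
    by (simp add: pairing3_tmult3 pairing3_legs, simp only: rep_mult sum_product3, simp only: mult_ac)
  also have "\<dots> = pairing3 (tmult3 (legs12 (?X b\<^sub>1\<^sub>2)) (tmult3 (legs13 (?X b\<^sub>1\<^sub>3)) (legs23 (?X b\<^sub>2\<^sub>3)))) ?\<phi>"
    using H.yang_baxter_crossings[OF assms] rep_trilinear by (simp add: H.same_pairing3_def)
  also have "\<dots> = pairing2 (?X b\<^sub>1\<^sub>2) (\<lambda>e e'. pairing2 (?X b\<^sub>1\<^sub>3) (\<lambda>c c'. pairing2 (?X b\<^sub>2\<^sub>3) (\<lambda>a a'.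
        \<Sum>i1\<in>B. \<Sum>j1\<in>B. \<Sum>k1\<in>B. (rep q a j j1 * rep r a' k k1) *
          (rep p c i i1 * rep r c' k1 k') * (rep p e i1 i' * rep q e' j1 j'))))"
    by (simp add: pairing3_tmult3 pairing3_legs, simp only: rep_mult sum_product3, simp only: mult_ac)
  also have "\<dots> = (\<Sum>i1\<in>B. \<Sum>j1\<in>B. \<Sum>k1\<in>B. cross_entry b\<^sub>2\<^sub>3 q r j k k1 j1 *
      cross_entry b\<^sub>1\<^sub>3 p r i k1 k' i1 * cross_entry b\<^sub>1\<^sub>2 p q i1 j1 j' i')"
    by (simp only: pairing2_sum3 cross_entry_def)
  finally show ?thesis .
qed

end

section \<open>Invariance of the matrices of diagrams\<close>

context link_evaluation
begin

definition indices :: "nat \<Rightarrow> 'v list set"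
  where "indices n = {\<beta>. set \<beta> \<subseteq> B \<and> length \<beta> = n}"

lemma finite_indices [simp]: "finite (indices n)"
  unfolding indices_def by (rule finite_lists_length_eq[OF V.finite_Basis])

lemma indices_0 [simp]: "indices 0 = {[]}"
  by (auto simp: indices_def)

lemma indices_Suc_iff: "\<beta> \<in> indices (Suc n) \<longleftrightarrow> (\<exists>x\<in>B. \<exists>\<gamma>\<in>indices n. \<beta> = x # \<gamma>)"
  by (auto simp: indices_def length_Suc_conv)

lemma length_indices: "\<beta> \<in> indices n \<Longrightarrow> length \<beta> = n"
  by (simp add: indices_def)

lemma take_drop_indices:
  assumes "\<beta> \<in> indices (m + n)"
  shows "take m \<beta> \<in> indices m" and "drop m \<beta> \<in> indices n"
  using assms set_take_subset[of m \<beta>] set_drop_subset[of m \<beta>] by (auto simp: indices_def)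

lemma sum_indices_Suc: "(\<Sum>\<beta>\<in>indices (Suc n). f \<beta>) = (\<Sum>x\<in>B. \<Sum>\<beta>\<in>indices n. f (x # \<beta>))"
  for f :: "'v list \<Rightarrow> 'k"
proof -
  have "(\<Sum>x\<in>B. \<Sum>\<beta>\<in>indices n. f (x # \<beta>)) = (\<Sum>(x, \<beta>)\<in>B \<times> indices n. f (x # \<beta>))"
    by (rule sum.cartesian_product)
  also have "\<dots> = (\<Sum>\<beta>\<in>indices (Suc n). f \<beta>)"
    by (rule sum.reindex_bij_witness[of _ "\<lambda>\<beta>. (hd \<beta>, tl \<beta>)" "\<lambda>(x, \<beta>). x # \<beta>"])
      (auto simp: indices_Suc_iff)
  finally show ?thesis ..
qed

lemma sum_indices_add:
  "(\<Sum>\<delta>\<in>indices (m + n). f \<delta>) = (\<Sum>\<beta>\<in>indices m. \<Sum>\<gamma>\<in>indices n. f (\<beta> @ \<gamma>))"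
  for f :: "'v list \<Rightarrow> 'k"
  by (induction m arbitrary: f) (simp_all add: sum_indices_Suc)

text \<open>
  In contrast to the evaluation, crossings of all orientation types are treated alike here; that
  resolving the mixed ones does not change the matrix is \<open>same_matrix_resolve\<close>. Labels of an end
  without strands are the empty list, so the matrix of a link diagram has one entry.
\<close>

primrec matrix :: "diagram \<Rightarrow> 'v list \<Rightarrow> 'v list \<Rightarrow> 'k" where
  "matrix (Strands w) = (\<lambda>\<beta> \<gamma>. if \<beta> = \<gamma> then 1 else 0)"
| "matrix (Cap p) = (\<lambda>\<beta> \<gamma>. cap_entry p (\<beta> ! 0) (\<beta> ! 1))"
| "matrix (Cup p) = (\<lambda>\<beta> \<gamma>. cup_entry p (\<gamma> ! 0) (\<gamma> ! 1))"
| "matrix (Cross b p q) = (\<lambda>\<beta> \<gamma>. cross_entry b p q (\<beta> ! 0) (\<beta> ! 1) (\<gamma> ! 0) (\<gamma> ! 1))"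
| "matrix (S \<Zsemi> T) = (\<lambda>\<beta> \<gamma>. \<Sum>\<delta>\<in>indices (length (target S)). matrix S \<beta> \<delta> * matrix T \<delta> \<gamma>)"
| "matrix (S \<oplus> T) = (\<lambda>\<beta> \<gamma>.
     matrix S (take (length (source S)) \<beta>) (take (length (target S)) \<gamma>) *
     matrix T (drop (length (source S)) \<beta>) (drop (length (target S)) \<gamma>))"

definition same_matrix :: "diagram \<Rightarrow> diagram \<Rightarrow> bool"
  where "same_matrix S T \<longleftrightarrow> source S = source T \<and> target S = target T \<and>
    (\<forall>\<beta>\<in>indices (length (source S)). \<forall>\<gamma>\<in>indices (length (target S)). matrix S \<beta> \<gamma> = matrix T \<beta> \<gamma>)"

lemma same_matrix_refl: "same_matrix S S"
  and same_matrix_sym: "same_matrix S T \<Longrightarrow> same_matrix T S"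
  and same_matrix_trans: "same_matrix S T \<Longrightarrow> same_matrix T U \<Longrightarrow> same_matrix S U"
  by (auto simp: same_matrix_def)

lemma same_matrix_stack:
  assumes "same_matrix S S'" and "same_matrix T T'" and "target S = source T"
  shows "same_matrix (S \<Zsemi> T) (S' \<Zsemi> T')"
  using assms by (auto simp: same_matrix_def intro!: sum.cong)

lemma same_matrix_juxt:
  assumes "same_matrix S S'" and "same_matrix T T'"
  shows "same_matrix (S \<oplus> T) (S' \<oplus> T')"
  using assms by (auto simp: same_matrix_def take_drop_indices)

lemma same_matrix_stack_assoc: "same_matrix (S \<Zsemi> T \<Zsemi> U) (S \<Zsemi> (T \<Zsemi> U))"
  by (auto simp: same_matrix_def sum_distrib_left sum_distrib_right mult.assoc intro: sum.swap)

lemma same_matrix_strands_left: "same_matrix (Strands (source S) \<Zsemi> S) S"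
  by (auto simp: same_matrix_def mult_delta)

lemma same_matrix_strands_right: "same_matrix (S \<Zsemi> Strands (target S)) S"
  by (auto simp: same_matrix_def mult_delta)

lemma same_matrix_juxt_assoc: "same_matrix (S \<oplus> T \<oplus> U) (S \<oplus> (T \<oplus> U))"
  by (auto simp: same_matrix_def mult.assoc drop_take add.commute)

lemma same_matrix_juxt_empty: "same_matrix (Strands [] \<oplus> S) S" "same_matrix (S \<oplus> Strands []) S"
  by (auto simp: same_matrix_def length_indices)

lemma same_matrix_juxt_strands: "same_matrix (Strands w \<oplus> Strands w') (Strands (w @ w'))"
  unfolding same_matrix_def by (auto, metis append_take_drop_id)

lemma same_matrix_interchange:
  assumes "target S = source T" and "target S' = source T'"
  shows "same_matrix ((S \<oplus> S') \<Zsemi> (T \<oplus> T')) ((S \<Zsemi> T) \<oplus> (S' \<Zsemi> T'))"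
  using assms
  by (auto simp: same_matrix_def sum_indices_add length_indices sum_product mult_ac intro!: sum.cong)

lemma sum_indices_0: "sum f (indices 0) = f []"
  for f :: "'v list \<Rightarrow> 'k"
  by simp

lemma sum_if_const: "(\<Sum>x\<in>A. if P then f x else 0) = (if P then \<Sum>x\<in>A. f x else 0)"
  for f :: "'x \<Rightarrow> 'k"
  by simp

lemma if_conj: "(if P \<and> Q then x else 0) = (if P then if Q then x else 0 else (0::'k))"
  by simp

text \<open>
  For diagrams with an explicit number of strands, these rules turn a sum over lists of labels into
  iterated sums over \<open>B\<close> and eliminate the labels that vertical strands force to coincide.
\<close>

lemmas expand_matrix = sum_indices_Suc sum_indices_0 sum_if_const if_conj mult_delta

lemma same_matrix_cancel_left:
  "same_matrix ((Strands [p] \<oplus> Cup (opp p)) \<Zsemi> (Cap p \<oplus> Strands [p])) (Strands [p])"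
  unfolding same_matrix_def
  by (simp split del: if_split, intro ballI, clarsimp simp: indices_Suc_iff split del: if_split,
      (simp add: expand_matrix V.finite_Basis split del: if_split)+, simp add: snake_left)

lemma same_matrix_cancel_right:
  "same_matrix ((Cup p \<oplus> Strands [p]) \<Zsemi> (Strands [p] \<oplus> Cap (opp p))) (Strands [p])"
  unfolding same_matrix_def
  by (simp split del: if_split, intro ballI, clarsimp simp: indices_Suc_iff split del: if_split,
      (simp add: expand_matrix V.finite_Basis split del: if_split)+, simp add: snake_right)

lemma same_matrix_switchback_cap:
  "same_matrix ((Cross b p q \<oplus> Strands [opp p]) \<Zsemi> (Strands [q] \<oplus> Cap p))
     ((Strands [p] \<oplus> Cross (\<not> b) q (opp p)) \<Zsemi> (Cap p \<oplus> Strands [q]))"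
  unfolding same_matrix_def
  by (simp split del: if_split, intro ballI, clarsimp simp: indices_Suc_iff split del: if_split,
      (simp add: expand_matrix V.finite_Basis split del: if_split)+, simp add: switchback_cap_entry)

lemma same_matrix_switchback_cup:
  "same_matrix ((Strands [q] \<oplus> Cup p) \<Zsemi> (Cross b q p \<oplus> Strands [opp p]))
     ((Cup p \<oplus> Strands [q]) \<Zsemi> (Strands [p] \<oplus> Cross (\<not> b) (opp p) q))"
  unfolding same_matrix_def
  by (simp split del: if_split, intro ballI, clarsimp simp: indices_Suc_iff split del: if_split,
      (simp add: expand_matrix V.finite_Basis split del: if_split)+, simp add: switchback_cup_entry)

lemma same_matrix_R2: "same_matrix (Cross b p q \<Zsemi> Cross (\<not> b) q p) (Strands [p, q])"
  unfolding same_matrix_def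
  by (simp split del: if_split, intro ballI, clarsimp simp: indices_Suc_iff split del: if_split,
      (simp add: expand_matrix V.finite_Basis split del: if_split)+, simp add: R2_entry)

lemma same_matrix_R3:
  assumes "b\<^sub>1\<^sub>2 = b\<^sub>2\<^sub>3 \<longrightarrow> b\<^sub>1\<^sub>3 = b\<^sub>1\<^sub>2"
  shows "same_matrix
    ((Cross b\<^sub>1\<^sub>2 p q \<oplus> Strands [r]) \<Zsemi> (Strands [q] \<oplus> Cross b\<^sub>1\<^sub>3 p r) \<Zsemi> (Cross b\<^sub>2\<^sub>3 q r \<oplus> Strands [p]))
    ((Strands [p] \<oplus> Cross b\<^sub>2\<^sub>3 q r) \<Zsemi> (Cross b\<^sub>1\<^sub>3 p r \<oplus> Strands [q]) \<Zsemi> (Strands [r] \<oplus> Cross b\<^sub>1\<^sub>2 p q))"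
proof -
  have R3: "(\<Sum>j1\<in>B. \<Sum>k1\<in>B. (\<Sum>i1\<in>B. cross_entry b\<^sub>1\<^sub>2 p q i j j1 i1 *
        cross_entry b\<^sub>1\<^sub>3 p r i1 k k1 i') * cross_entry b\<^sub>2\<^sub>3 q r j1 k1 k' j') =
      (\<Sum>i1\<in>B. \<Sum>j1\<in>B. (\<Sum>k1\<in>B. cross_entry b\<^sub>2\<^sub>3 q r j k k1 j1 *
        cross_entry b\<^sub>1\<^sub>3 p r i k1 k' i1) * cross_entry b\<^sub>1\<^sub>2 p q i1 j1 j' i')" (is "?l = ?r") for i j k i' j' k'
  proof -
    have "?l = (\<Sum>j1\<in>B. \<Sum>i1\<in>B. \<Sum>k1\<in>B. cross_entry b\<^sub>1\<^sub>2 p q i j j1 i1 *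
        cross_entry b\<^sub>1\<^sub>3 p r i1 k k1 i' * cross_entry b\<^sub>2\<^sub>3 q r j1 k1 k' j')"
      by (simp only: sum_distrib_right, rule sum.cong[OF HOL.refl], rule sum.swap)
    also have "\<dots> = (\<Sum>i1\<in>B. \<Sum>j1\<in>B. \<Sum>k1\<in>B. cross_entry b\<^sub>1\<^sub>2 p q i j j1 i1 *
        cross_entry b\<^sub>1\<^sub>3 p r i1 k k1 i' * cross_entry b\<^sub>2\<^sub>3 q r j1 k1 k' j')"
      by (rule sum.swap)
    also have "\<dots> = ?r"
      by (simp only: R3_entry[OF assms] sum_distrib_right)
    finally show ?thesis .
  qed
  show ?thesis
    unfolding same_matrix_def
    by (simp split del: if_split, intro ballI, clarsimp simp: indices_Suc_iff split del: if_split,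
        (simp add: expand_matrix V.finite_Basis split del: if_split)+, simp only: R3)
qed

text \<open>
  By a switchback move along the cap, the bent strand crosses directly; the cup and cap that remain
  cancel.
\<close>

lemma same_matrix_mixed_crossing:
  assumes "p \<noteq> q"
  shows "same_matrix
    ((Strands [p, q] \<oplus> Cup q) \<Zsemi> (Strands [p] \<oplus> Cross (\<not> b) q q \<oplus> Strands [p]) \<Zsemi>
       (Cap p \<oplus> Strands [q, p])) (Cross b p q)"
proof -
  have q: "q = opp p"
    using assms by (cases p; cases q) auto
  have entry: "(\<Sum>u\<in>B. (\<Sum>m\<in>B. cup_entry (opp p) m n * cross_entry (\<not> b) (opp p) (opp p) j m u l) *
      cap_entry p i u) = cross_entry b p (opp p) i j l n" (is "?l = _")
    if B: "i \<in> B" "j \<in> B" "l \<in> B" "n \<in> B" for i j l n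
  proof -
    have "?l = (\<Sum>m\<in>B. \<Sum>u\<in>B. cup_entry (opp p) m n * cross_entry (\<not> b) (opp p) (opp p) j m u l * cap_entry p i u)"
      by (simp only: sum_distrib_right, rule sum.swap)
    also have "\<dots> = (\<Sum>m\<in>B. cup_entry (opp p) m n * (\<Sum>w\<in>B. cross_entry b p (opp p) i j l w * cap_entry p w m))"
      using B by (simp add: switchback_cap_entry sum_distrib_left mult.assoc)
    also have "\<dots> = (\<Sum>w\<in>B. cross_entry b p (opp p) i j l w * (\<Sum>m\<in>B. cup_entry (opp p) m n * cap_entry p w m))"
      by (simp only: sum_distrib_left mult_ac, rule sum.swap)
    also have "\<dots> = cross_entry b p (opp p) i j l n"
      using B V.finite_Basis by (simp add: snake_left mult_delta)
    finally show ?thesis .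
  qed
  show ?thesis
    unfolding q same_matrix_def
    by (simp split del: if_split, intro ballI, clarsimp simp: indices_Suc_iff split del: if_split,
        (simp add: expand_matrix V.finite_Basis split del: if_split)+, simp add: entry)
qed

lemma regularly_isotopic_same_matrix:
  assumes "S \<approx> T"
  shows "same_matrix S T"
  using assms
proof induction
  case (interchange S T S' T')
  then show ?case by (intro same_matrix_interchange) auto
qed (auto intro: same_matrix_refl same_matrix_sym same_matrix_trans same_matrix_stack same_matrix_juxt
    same_matrix_stack_assoc same_matrix_strands_left same_matrix_strands_right same_matrix_juxt_assoc
    same_matrix_juxt_empty same_matrix_juxt_strands same_matrix_cancel_left same_matrix_cancel_right
    same_matrix_switchback_cap same_matrix_switchback_cup same_matrix_R2 same_matrix_R3)

lemma same_matrix_resolve: "composable S \<Longrightarrow> same_matrix (resolve S) S"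
proof (induction S)
  case (Cross b p q)
  show ?case
    using same_matrix_mixed_crossing[of p q b] by (simp add: same_matrix_refl)
qed (auto intro: same_matrix_refl same_matrix_stack same_matrix_juxt)

end

section \<open>Evaluation in coordinates\<close>

context link_evaluation
begin

primrec letter_coord :: "('v, 'k) letter \<Rightarrow> 'v \<Rightarrow> 'k" where
  "letter_coord (Vec x) \<beta> = coord \<beta> x"
| "letter_coord (Form f) \<beta> = f \<beta>"

definition word_coord :: "('v, 'k) letter list \<Rightarrow> 'v list \<Rightarrow> 'k"
  where "word_coord w \<beta> = prod_list (map2 letter_coord w \<beta>)"

lemma word_coord_simps [simp]:
  "word_coord [] \<gamma> = 1" "word_coord w [] = 1"
  "word_coord (x # w) (\<beta> # \<gamma>) = letter_coord x \<beta> * word_coord w \<gamma>"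
  by (simp_all add: word_coord_def)

lemma word_coord_append:
  "length w = length \<beta> \<Longrightarrow> word_coord (w @ w') (\<beta> @ \<gamma>) = word_coord w \<beta> * word_coord w' \<gamma>"
  by (induction w \<beta> rule: list_induct2) auto

text \<open>
  A letter may hold an arbitrary function on \<open>V\<close>, but only linear ones are determined by their
  values on \<open>B\<close>.
\<close>

definition proper_word :: "orient list \<Rightarrow> ('v, 'k) letter list \<Rightarrow> bool"
  where "proper_word p w \<longleftrightarrow> map letter_orient w = p \<and>
    (\<forall>f. Form f \<in> set w \<longrightarrow> Vector_Spaces.linear scaleV (*) f)"

lemma proper_word_simps [simp]:
  "proper_word [] w \<longleftrightarrow> w = []"
  "proper_word (Up # p) w \<longleftrightarrow> (\<exists>x w'. w = Vec x # w' \<and> proper_word p w')"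
  "proper_word (Down # p) w \<longleftrightarrow>
     (\<exists>f w'. w = Form f # w' \<and> Vector_Spaces.linear scaleV (*) f \<and> proper_word p w')"
proof -
  have Up: "letter_orient l = Up \<longleftrightarrow> (\<exists>x. l = Vec x)" and Down: "letter_orient l = Down \<longleftrightarrow> (\<exists>f. l = Form f)"
    for l :: "('v, 'k) letter"
    by (cases l; simp)+
  show "proper_word [] w \<longleftrightarrow> w = []"
    by (auto simp: proper_word_def)
  show "proper_word (Up # p) w \<longleftrightarrow> (\<exists>x w'. w = Vec x # w' \<and> proper_word p w')"
    by (auto simp: proper_word_def map_eq_Cons_conv Up)
  show "proper_word (Down # p) w \<longleftrightarrow>
     (\<exists>f w'. w = Form f # w' \<and> Vector_Spaces.linear scaleV (*) f \<and> proper_word p w')"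
    by (auto simp: proper_word_def map_eq_Cons_conv Down)
qed

lemma proper_word_append: "proper_word p w \<Longrightarrow> proper_word q w' \<Longrightarrow> proper_word (p @ q) (w @ w')"
  by (auto simp: proper_word_def)

lemma proper_word_take_drop:
  assumes "proper_word (p @ q) w"
  shows "proper_word p (take (length p) w)" and "proper_word q (drop (length p) w)"
  using assms in_set_takeD[of _ "length p" w] in_set_dropD[of _ "length p" w]
  by (auto simp: proper_word_def simp flip: take_map drop_map)

lemma proper_word_length: "proper_word p w \<Longrightarrow> length w = length p"
  by (auto simp: proper_word_def)

text \<open>
  \<open>F\<close> is a map on words, not on tensors; it is described by \<open>M\<close> after passing to coordinates, which
  depend on a word only through the tensor that it stands for.
\<close>

definition represents ::
    "(('v, 'k) letter list \<Rightarrow> (('v, 'k) letter list \<Rightarrow>\<^sub>0 'k)) \<Rightarrow> orient list \<Rightarrow> orient list \<Rightarrow>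
     ('v list \<Rightarrow> 'v list \<Rightarrow> 'k) \<Rightarrow> bool"
  where "represents F p q M \<longleftrightarrow> (\<forall>w. proper_word p w \<longrightarrow>
    Poly_Mapping.keys (F w) \<subseteq> Collect (proper_word q) \<and>
    (\<forall>\<gamma>\<in>indices (length q). form_ext (\<lambda>u. word_coord u \<gamma>) (F w) =
      (\<Sum>\<beta>\<in>indices (length p). word_coord w \<beta> * M \<beta> \<gamma>)))"

lemma form_ext_cong:
  "(\<And>w. w \<in> Poly_Mapping.keys x \<Longrightarrow> \<phi> w = \<psi> w) \<Longrightarrow> form_ext \<phi> x = form_ext \<psi> x"
  by (simp add: form_ext_def)

lemma form_ext_form_sum:
  "form_ext (\<lambda>w. \<Sum>i\<in>A. f w i * c i) x = (\<Sum>i\<in>A. form_ext (\<lambda>w. f w i) x * c i)"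
  by (simp add: form_ext_def sum_distrib_left sum_distrib_right mult.assoc, rule sum.swap)

lemma form_ext_form_mult: "form_ext (\<lambda>w. c * f w) x = c * form_ext f x"
  by (simp add: form_ext_def sum_distrib_left mult.left_commute)

lemma form_ext_form_mult_right: "form_ext (\<lambda>w. f w * c) x = form_ext f x * c"
  by (simp add: form_ext_def sum_distrib_right mult.assoc)

lemma represents_pure: "represents pure p p (matrix (Strands p))"
  by (auto simp: represents_def mult_delta)

lemma represents_stack:
  assumes "represents F p q M" and "represents F' q r M'"
  shows "represents (\<lambda>w. lin_ext F' (F w)) p r (\<lambda>\<beta> \<gamma>. \<Sum>\<delta>\<in>indices (length q). M \<beta> \<delta> * M' \<delta> \<gamma>)"
  unfolding represents_def
proof (intro allI impI conjI ballI)
  fix w assume w: "proper_word p w"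
  then have keys: "Poly_Mapping.keys (F w) \<subseteq> Collect (proper_word q)"
    using assms(1) by (auto simp: represents_def)
  then show "Poly_Mapping.keys (lin_ext F' (F w)) \<subseteq> Collect (proper_word r)"
    using assms(2) keys_lin_ext[of F' "F w"] unfolding represents_def by fast
  fix \<gamma> assume \<gamma>: "\<gamma> \<in> indices (length r)"
  have "form_ext (\<lambda>u. word_coord u \<gamma>) (lin_ext F' (F w)) =
      form_ext (\<lambda>x. form_ext (\<lambda>u. word_coord u \<gamma>) (F' x)) (F w)"
    by (rule form_ext_lin_ext)
  also have "\<dots> = form_ext (\<lambda>x. \<Sum>\<delta>\<in>indices (length q). word_coord x \<delta> * M' \<delta> \<gamma>) (F w)"
    using keys assms(2) \<gamma> by (intro form_ext_cong) (auto simp: represents_def)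
  also have "\<dots> = (\<Sum>\<delta>\<in>indices (length q). (\<Sum>\<beta>\<in>indices (length p). word_coord w \<beta> * M \<beta> \<delta>) * M' \<delta> \<gamma>)"
    using assms(1) w by (simp add: form_ext_form_sum represents_def)
  also have "\<dots> = (\<Sum>\<beta>\<in>indices (length p). word_coord w \<beta> * (\<Sum>\<delta>\<in>indices (length q). M \<beta> \<delta> * M' \<delta> \<gamma>))"
    by (simp add: sum_distrib_left sum_distrib_right mult.assoc, rule sum.swap)
  finally show "form_ext (\<lambda>u. word_coord u \<gamma>) (lin_ext F' (F w)) =
      (\<Sum>\<beta>\<in>indices (length p). word_coord w \<beta> * (\<Sum>\<delta>\<in>indices (length q). M \<beta> \<delta> * M' \<delta> \<gamma>))" .
qed

lemma represents_juxt:
  assumes "represents F p q M" and "represents F' p' q' M'"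
  shows "represents
    (\<lambda>w. lin_ext (\<lambda>x. lin_ext (\<lambda>y. pure (x @ y)) (F' (drop (length p) w))) (F (take (length p) w)))
    (p @ p') (q @ q')
    (\<lambda>\<beta> \<gamma>. M (take (length p) \<beta>) (take (length q) \<gamma>) * M' (drop (length p) \<beta>) (drop (length q) \<gamma>))"
  unfolding represents_def
proof (intro allI impI conjI ballI)
  fix w assume "proper_word (p @ p') w"
  define w1 w2 where "w1 = take (length p) w" and "w2 = drop (length p) w"
  have w: "w = w1 @ w2" "proper_word p w1" "proper_word p' w2"
    using \<open>proper_word (p @ p') w\<close> by (auto simp: w1_def w2_def proper_word_take_drop)
  have keys1: "Poly_Mapping.keys (F w1) \<subseteq> Collect (proper_word q)"
    and keys2: "Poly_Mapping.keys (F' w2) \<subseteq> Collect (proper_word q')"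
    using assms w by (auto simp: represents_def)
  let ?F = "lin_ext (\<lambda>x. lin_ext (\<lambda>y. pure (x @ y)) (F' w2)) (F w1)"
  show "Poly_Mapping.keys (lin_ext (\<lambda>x. lin_ext (\<lambda>y. pure (x @ y)) (F' (drop (length p) w)))
      (F (take (length p) w))) \<subseteq> Collect (proper_word (q @ q'))"
    using keys1 keys2 unfolding w1_def[symmetric] w2_def[symmetric]
    by (auto elim!: keys_lin_extE intro!: proper_word_append)
  fix \<gamma> assume \<gamma>: "\<gamma> \<in> indices (length (q @ q'))"
  define \<gamma>1 \<gamma>2 where "\<gamma>1 = take (length q) \<gamma>" and "\<gamma>2 = drop (length q) \<gamma>"
  have \<gamma>': "\<gamma> = \<gamma>1 @ \<gamma>2" "\<gamma>1 \<in> indices (length q)" "\<gamma>2 \<in> indices (length q')"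
    using \<gamma> by (auto simp: \<gamma>1_def \<gamma>2_def take_drop_indices)
  have "form_ext (\<lambda>u. word_coord u \<gamma>) ?F =
      form_ext (\<lambda>x. form_ext (\<lambda>y. word_coord (x @ y) (\<gamma>1 @ \<gamma>2)) (F' w2)) (F w1)"
    by (simp add: form_ext_lin_ext \<gamma>'(1))
  also have "\<dots> = form_ext (\<lambda>x. word_coord x \<gamma>1 * form_ext (\<lambda>y. word_coord y \<gamma>2) (F' w2)) (F w1)"
    using keys1 \<gamma>'(2)
    by (intro form_ext_cong)
      (auto simp: word_coord_append proper_word_length length_indices form_ext_form_mult[symmetric]
        dest!: subsetD)
  also have "\<dots> = form_ext (\<lambda>y. word_coord y \<gamma>2) (F' w2) * form_ext (\<lambda>x. word_coord x \<gamma>1) (F w1)"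
    by (simp only: form_ext_form_mult_right mult.commute)
  also have "\<dots> = (\<Sum>\<beta>'\<in>indices (length p'). word_coord w2 \<beta>' * M' \<beta>' \<gamma>2) *
      (\<Sum>\<beta>\<in>indices (length p). word_coord w1 \<beta> * M \<beta> \<gamma>1)"
    using assms w \<gamma>' by (simp add: represents_def)
  also have "\<dots> = (\<Sum>\<beta>\<in>indices (length (p @ p')). word_coord w \<beta> *
      (M (take (length p) \<beta>) \<gamma>1 * M' (drop (length p) \<beta>) \<gamma>2))"
    using w(2) by (subst mult.commute)
      (simp add: sum_indices_add sum_product w(1) word_coord_append length_indices proper_word_length mult_ac
        cong: sum.cong)
  finally show "form_ext (\<lambda>u. word_coord u \<gamma>)
      (lin_ext (\<lambda>x. lin_ext (\<lambda>y. pure (x @ y)) (F' (drop (length p) w))) (F (take (length p) w))) =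
    (\<Sum>\<beta>\<in>indices (length (p @ p')). word_coord w \<beta> *
      (M (take (length p) \<beta>) (take (length q) \<gamma>) * M' (drop (length p) \<beta>) (drop (length q) \<gamma>)))"
    by (simp add: w1_def w2_def \<gamma>1_def \<gamma>2_def)
qed

lemma linear_expand_commuted:
  assumes "Vector_Spaces.linear scaleV (*) f"
  shows "f x = (\<Sum>\<beta>\<in>B. f \<beta> * coord \<beta> x)"
  by (subst linear_expand[OF assms]) (simp only: mult.commute)

lemma keys_fscale_pure: "Poly_Mapping.keys (fscale c (pure w)) \<subseteq> {w}"
  by (auto simp: in_keys_iff lookup_single when_def split: if_splits)

lemma represents_cap: "represents (eval_cap act Ginv p) [p, opp p] [] (matrix (Cap p))"
proof (cases p)
  case Up
  have "f (act Ginv x) = (\<Sum>\<beta>\<in>B. \<Sum>\<gamma>\<in>B. coord \<beta> x * (f \<gamma> * coord \<gamma> (act Ginv \<beta>)))"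
    if f: "Vector_Spaces.linear scaleV (*) f" for f x
  proof -
    have "f (act Ginv x) = (\<Sum>\<beta>\<in>B. coord \<beta> x * f (act Ginv \<beta>))"
      by (rule linear_expand[OF act_form_linear(1)[OF f]])
    also have "\<dots> = (\<Sum>\<beta>\<in>B. coord \<beta> x * (\<Sum>\<gamma>\<in>B. f \<gamma> * coord \<gamma> (act Ginv \<beta>)))"
      by (simp only: linear_expand_commuted[OF f, symmetric])
    finally show ?thesis
      by (simp only: sum_distrib_left)
  qed
  then show ?thesis
    using Up keys_fscale_pure[of _ "[]"]
    by (fastforce simp: represents_def sum_indices_Suc sum_indices_0 cap_entry_def mult.assoc)
next
  case Down
  have "(\<Sum>\<beta>\<in>B. \<Sum>\<gamma>\<in>B. f \<beta> * (coord \<gamma> x * (if \<beta> = \<gamma> then 1 else 0))) = f x"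
    if f: "Vector_Spaces.linear scaleV (*) f" for f x
  proof -
    have "(\<Sum>\<beta>\<in>B. \<Sum>\<gamma>\<in>B. f \<beta> * (coord \<gamma> x * (if \<beta> = \<gamma> then 1 else 0))) =
        (\<Sum>\<beta>\<in>B. f \<beta> * coord \<beta> x)"
      using V.finite_Basis by (intro sum.cong) (simp_all add: mult_delta)
    also have "\<dots> = f x"
      by (rule linear_expand_commuted[OF f, symmetric])
    finally show ?thesis .
  qed
  then show ?thesis
    using Down keys_fscale_pure[of _ "[]"]
    by (fastforce simp: represents_def sum_indices_Suc sum_indices_0 cap_entry_def mult.assoc)
qed

lemma represents_cup: "represents (eval_cup scaleV B act G p) [] [p, opp p] (matrix (Cup p))"
proof -
  have "Poly_Mapping.keys (eval_cup scaleV B act G p []) \<subseteq> Collect (proper_word [p, opp p])"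
    by (cases p) (auto intro!: keys_sum_subset simp: coord_linear)
  moreover have "form_ext (\<lambda>u. word_coord u [\<gamma>, \<delta>]) (eval_cup scaleV B act G p []) = cup_entry p \<gamma> \<delta>"
    if "\<gamma> \<in> B" "\<delta> \<in> B" for \<gamma> \<delta>
    using that V.finite_Basis
    by (cases p) (auto simp: form_ext_sum coord_basis cup_entry_def mult_delta)
  ultimately show ?thesis
    by (auto simp: represents_def indices_Suc_iff)
qed

lemma form_ext_pairs:
  "form_ext \<psi> (\<Sum>(a, b)\<leftarrow>xs. F a b) = pairing2 xs (\<lambda>a b. form_ext \<psi> (F a b))"
  by (induction xs) auto

lemma pairing2_expand:
  assumes f: "\<And>a. f a = (\<Sum>\<beta>\<in>A. x \<beta> * f' \<beta> a)" and g: "\<And>a. g a = (\<Sum>\<gamma>\<in>A. y \<gamma> * g' \<gamma> a)"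
  shows "pairing2 xs (\<lambda>a a'. g a' * f a) =
    (\<Sum>\<beta>\<in>A. \<Sum>\<gamma>\<in>A. x \<beta> * y \<gamma> * pairing2 xs (\<lambda>a a'. f' \<beta> a * g' \<gamma> a'))"
proof -
  have "g a' * f a = (\<Sum>\<beta>\<in>A. \<Sum>\<gamma>\<in>A. x \<beta> * y \<gamma> * (f' \<beta> a * g' \<gamma> a'))" for a a'
    unfolding f g by (subst mult.commute, simp only: sum_product mult_ac)
  then show ?thesis
    by (simp only: pairing2_sum pairing2_mult_left)
qed

text \<open>
  The rule for two downward strands uses the transposes without antipodes. It agrees with the
  dual representation because the crossing tensors are invariant under \<open>s \<otimes> s\<close>.
\<close>

lemma represents_cross: "represents (eval_cross act R Rinv b p p) [p, p] [p, p] (matrix (Cross b p p))"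
proof (cases p)
  case Up
  have keys: "Poly_Mapping.keys (eval_cross act R Rinv b Up Up [Vec x, Vec y]) \<subseteq> Collect (proper_word [Up, Up])"
    for x y
    by (cases b) (auto intro!: keys_sum_list_subset split: prod.splits)
  have "form_ext (\<lambda>u. word_coord u [l, m]) (eval_cross act R Rinv b Up Up [Vec x, Vec y]) =
      (\<Sum>i\<in>B. \<Sum>j\<in>B. coord i x * coord j y * cross_entry b Up Up i j l m)" for x y l m
  proof -
    have "form_ext (\<lambda>u. word_coord u [l, m]) (eval_cross act R Rinv b Up Up [Vec x, Vec y]) =
        pairing2 (H.crossing_tensor b) (\<lambda>a a'. coord l (act a' y) * coord m (act a x))"
      by (cases b) (simp_all add: form_ext_pairs H.crossing_tensor_def pairing2_flip2)
    also have "\<dots> = (\<Sum>i\<in>B. \<Sum>j\<in>B. coord i x * coord j y *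
        pairing2 (H.crossing_tensor b) (\<lambda>a a'. coord m (act a i) * coord l (act a' j)))"
      by (rule pairing2_expand; rule linear_expand[OF act_form_linear(1)[OF coord_linear]])
    finally show ?thesis
      by (simp add: cross_entry_def rep_def)
  qed
  with keys show ?thesis
    by (auto simp: Up represents_def indices_Suc_iff sum_indices_Suc sum_indices_0 mult.assoc)
next
  case Down
  have keys: "Poly_Mapping.keys (eval_cross act R Rinv b Down Down [Form f, Form g]) \<subseteq>
      Collect (proper_word [Down, Down])"
    if "Vector_Spaces.linear scaleV (*) f" "Vector_Spaces.linear scaleV (*) g" for f g
    using that act_form_linear(1)
    by (cases b) (auto intro!: keys_sum_list_subset simp: transp_def split: prod.splits)
  have "form_ext (\<lambda>u. word_coord u [l, m]) (eval_cross act R Rinv b Down Down [Form f, Form g]) =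
      (\<Sum>i\<in>B. \<Sum>j\<in>B. f i * g j * cross_entry b Down Down i j l m)"
    if f: "Vector_Spaces.linear scaleV (*) f" and g: "Vector_Spaces.linear scaleV (*) g" for f g l m
  proof -
    have \<phi>: "bilinear_form scale (\<lambda>a a'. g (act a' l) * f (act a m))"
      using act_form_linear(2)[OF f] act_form_linear(2)[OF g]
      by (simp add: bilinear_form_def H.linear_form_iff algebra_simps)
    have "form_ext (\<lambda>u. word_coord u [l, m]) (eval_cross act R Rinv b Down Down [Form f, Form g]) =
        pairing2 (H.crossing_tensor b) (\<lambda>a a'. g (act a' l) * f (act a m))"
      by (cases b) (simp_all add: form_ext_pairs H.crossing_tensor_def pairing2_flip2 transp_def)
    also have "\<dots> = pairing2 (H.crossing_tensor b) (\<lambda>a a'. g (act (antipode a') l) * f (act (antipode a) m))"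
      by (rule H.pairing_crossing_tensor_antipode_antipode[OF \<phi>, symmetric])
    also have "\<dots> = (\<Sum>i\<in>B. \<Sum>j\<in>B. f i * g j *
        pairing2 (H.crossing_tensor b) (\<lambda>a a'. coord i (act (antipode a) m) * coord j (act (antipode a') l)))"
      by (rule pairing2_expand, rule linear_expand_commuted[OF f], rule linear_expand_commuted[OF g])
    finally show ?thesis
      by (simp add: cross_entry_def rep_def)
  qed
  with keys show ?thesis
    by (auto simp: Down represents_def indices_Suc_iff sum_indices_Suc sum_indices_0 mult.assoc)
qed

lemma represents_eval_resolved:
  "composable S \<Longrightarrow> represents (eval_resolved scaleV B act R Rinv G Ginv (resolve S))
     (source S) (target S) (matrix (resolve S))"
proof (induction S)
  case (Strands w)
  show ?case by (simp only: resolve.simps eval_resolved.simps source.simps target.simps represents_pure)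
next
  case (Cap p)
  show ?case by (simp only: resolve.simps eval_resolved.simps source.simps target.simps represents_cap)
next
  case (Cup p)
  show ?case by (simp only: resolve.simps eval_resolved.simps source.simps target.simps represents_cup)
next
  case (Cross b p q)
  let ?e = "eval_resolved scaleV B act R Rinv G Ginv" and ?juxt = "\<lambda>S T. S \<oplus> T"
  define rep where "rep S \<longleftrightarrow> represents (?e S) (source S) (target S) (matrix S)" for S
  have stack: "rep (S \<Zsemi> T)" if "rep S" "rep T" "target S = source T" for S T
    using represents_stack[of "?e S" "source S" "target S"] that by (simp add: rep_def)
  have juxt: "rep (S \<oplus> T)" if "rep S" "rep T" for S T
    using represents_juxt[of "?e S" "source S" "target S"] that by (simp add: rep_def)
  have "rep (Cross b p p)" "rep (Cap p)" "rep (Cup p)" "rep (Strands w)" for b p w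
    unfolding rep_def using represents_cross represents_cap represents_cup represents_pure
    by (simp_all only: eval_resolved.simps source.simps target.simps)
  then have "rep (resolve (Cross b p q))"
    by (cases p; cases q) (auto intro!: stack juxt)
  then show ?case
    by (simp only: rep_def resolve_shape)
next
  case (Stack S T)
  then show ?case
    using represents_stack[of "eval_resolved scaleV B act R Rinv G Ginv (resolve S)" "source S" "target S"]
    by simp
next
  case (Juxt S T)
  then show ?case
    using represents_juxt[of "eval_resolved scaleV B act R Rinv G Ginv (resolve S)" "source S" "target S"]
    by simp
qed

lemma link_value_matrix:
  assumes "link_diagram D"
  shows "link_value scaleV B act R Rinv G Ginv D = matrix D [] []"
proof -
  have D: "composable D" "source D = []" "target D = []"
    using assms by (auto simp: link_diagram_def)
  have "link_value scaleV B act R Rinv G Ginv D =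
      form_ext (\<lambda>u. word_coord u []) (eval scaleV B act R Rinv G Ginv D [])"
    by (simp add: eval_link_diagram[OF assms])
  also have "\<dots> = matrix (resolve D) [] []"
    using represents_eval_resolved[OF D(1)] D by (simp add: represents_def eval_def)
  also have "\<dots> = matrix D [] []"
    using same_matrix_resolve[OF D(1)] D by (simp add: same_matrix_def)
  finally show ?thesis .
qed

end

theorem mainTheorem4:
  fixes scale :: "'k::field \<Rightarrow> 'a::ring_1 \<Rightarrow> 'a"
    and comult :: "'a \<Rightarrow> ('a \<times> 'a) list"
    and counit :: "'a \<Rightarrow> 'k"
    and antipode :: "'a \<Rightarrow> 'a"
    and R Rinv :: "('a \<times> 'a) list"
    and v G Ginv :: 'a
    and scaleV :: "'k \<Rightarrow> 'v::ab_group_add \<Rightarrow> 'v"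
    and B :: "'v set"
    and act :: "'a \<Rightarrow> 'v \<Rightarrow> 'v"
    and D D' :: diagram
  assumes "ribbon_hopf_algebra scale comult counit antipode R Rinv v"
    and "grouplike scale comult counit G"
    and "G * Ginv = 1" and "Ginv * G = 1"
    and "\<And>a. antipode (antipode a) = Ginv * a * G"
    and "fin_dim_representation scale scaleV B act"
    and "link_diagram D" and "link_diagram D'"
    and "D \<approx> D'"
  shows "link_value scaleV B act R Rinv G Ginv D = link_value scaleV B act R Rinv G Ginv D'"
proof -
  interpret link_evaluation scale comult counit antipode R Rinv scaleV B act G Ginv
    using assms(1-6)
    by (intro link_evaluation.intro link_evaluation_axioms.intro)
      (auto simp: ribbon_hopf_algebra_def)
  have "matrix D [] [] = matrix D' [] []"
    using regularly_isotopic_same_matrix[OF assms(9)] assms(7)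
    by (simp add: same_matrix_def link_diagram_def)
  then show ?thesis
    using assms(7,8) by (simp add: link_value_matrix)
qed

end
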